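(* There is a functor $\mathrm{ST\lambda C}_{\mathrm{cat}}\to\mathcal E\mathrm{Lens}(\mathbf P_{\mathrm{cat}})\xrightarrow{G}\mathcal E\mathrm{Dial}(\mathbf P_{\mathrm{cat}})$ (the composite of the functor $\mathrm{ST\lambda C}_{\mathrm{cat}}\to\mathcal E\mathrm{Lens}(\mathbf P_{\mathrm{cat}})$ described in the context with $G$) sending a simple type $A$ to $(W(A),\mathcal M[C(A)],1)$ and a term $(x:A\vdash_{\mathrm{ST\lambda C}}M:B)$ to the arrow from $(W(A),\mathcal M[C(A)],1)$ to $(W(B),\mathcal M[C(B)],1)$ given by the pair $$(x:W(A)\vdash_{\mathbf P}M^\bullet:W(B)),\qquad(z:W(A)\times\mathcal M[C(B)]\vdash_{\mathbf P}z^2\mathbin{>\!\!>\!=}M_{(z^1)}:\mathcal M[C(A)]),$$ where $M_{(z^1)}:=M_x\{z^1/x\}$. For $z:=\langle x,[y]\rangle$ with $y:C(B)$ not free in $M_x$, the latter term becomes $M_x\,y$, i.e. (abstracting over $y$) it becomes $x:W(A)\vdash_{\mathbf P}M_x:C(B)\to\mathcal M[C(A)]$.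
   Context: **The calculus $\mathbf P$.** $\mathrm{ST\lambda C}$ is the simply typed $\lambda$-calculus (types: ground types $\alpha$ and arrows $E\to F$) modulo $\beta\eta$. $\mathbf P$ is a simply typed $\lambda$-calculus with arrow types, product types $T\times U$ (pairs $\langle M,N\rangle$, projections $M^1,M^2$) and a type constructor $\mathcal M[T]$ with terms: return $[M]:\mathcal M[T]$ for $M:T$; bind $M\mathbin{>\!\!>\!=}N:\mathcal M[U]$ for $M:\mathcal M[T]$, $N:T\to\mathcal M[U]$; $0:\mathcal M[T]$; $M+N:\mathcal M[T]$. Its equational theory $=$ is the congruence generated by $\beta\eta$ (including surjective pairing), the monad laws for return/bind, the commutative monoid laws for $(0,+)$, and compatibility of bind with the monoid structure in both arguments ($0\mathbin{>\!\!>\!=}N=0$, $(M+M')\mathbin{>\!\!>\!=}N=(M\mathbin{>\!\!>\!=}N)+(M'\mathbin{>\!\!>\!=}N)$, $M\mathbin{>\!\!>\!=}\lambda x.0=0$, $M\mathbin{>\!\!>\!=}\lambda x.(N+N')=(M\mathbin{>\!\!>\!=}\lambda x.N)+(M\mathbin{>\!\!>\!=}\lambda x.N')$). **Dialectica.** For each ground type $\alpha$ fix ground $\mathbf P$-types $\alpha_W,\alpha_C$. Define $W(\alpha)=\alpha_W$, $C(\alpha)=\alpha_C$, $W(E\to F)=(W(E)\to W(F))\times(W(E)\times C(F)\to\mathcal M[C(E)])$, $C(E\to F)=W(E)\times C(F)$. On $\lambda$-terms define $\mathbf P$-terms: $x^\bullet=x$; $(\lambda x.M)^\bullet=\langle\lambda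 x.M^\bullet,\ \lambda\pi.(\lambda x.M_x)\pi^1\pi^2\rangle$; $(PQ)^\bullet=(P^\bullet)^1Q^\bullet$; and for each variable $y$: $y_y=\lambda\pi.[\pi]$; $x_y=\lambda\pi.0$ if $x\neq y$; $(\lambda x.M)_y=\lambda\pi.(\lambda x.M_y)\pi^1\pi^2$ ($x\ne y$); $(PQ)_y=\lambda\pi.\big(P_y\langle Q^\bullet,\pi\rangle+((P^\bullet)^2\langle Q^\bullet,\pi\rangle\mathbin{>\!\!>\!=}Q_y)\big)$. If $x:A\vdash M:B$ then $x:W(A)\vdash_{\mathbf P}M^\bullet:W(B)$ and $x:W(A)\vdash_{\mathbf P}M_x:C(B)\to\mathcal M[C(A)]$. **Syntactic categories.** $\mathrm{ST\lambda C}_{\mathrm{cat}}$ and $\mathbf P_{\mathrm{cat}}$ have types as objects; an arrow $A\to B$ is an equivalence class, modulo the equational theory, of terms $z:A\vdash M:B$; identities are variables; composition is substitution. **Euclidean lenses and $\mathcal E\mathrm{Dial}$.** For a category $\mathcal L$ with binary products (diagrammatic composition), $\mathcal E\mathrm{Lens}(\mathcal L)$ has as objects the first projections $\pi_1:A\times X\to A$; an arrow from $\pi_1:A\times X\to A$ to $\pi_1:B\times Y\to B$ is an $f:A\to B$ together with a span $A\times X\xleftarrow{F}A\times Y\xrightarrow{f\times1}B\times Y$ such that $F;\pi_1=\pi_1$; identities are $1_A$ with the identity span; the composite of $(f,F)$ and $(g,G)$, with $(g,G)$ from $\pi_1:B\times Y\to B$ to $\pi_1:C\times Z\to C$, has first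 component $f;g$ and span $A\times X\xleftarrow{\langle\pi_1,(f\times1);G;\pi_2\rangle;F}A\times Z\xrightarrow{(f;g)\times1}C\times Z$. $\mathcal E\mathrm{Dial}(\mathcal L)$ has objects $(A,X,1_{A\times X})$; arrows $(A,X,1)\to(B,Y,1)$ are pairs $f:A\to B$, $F:A\times Y\to X$; identity $(1_A,\pi_2)$; composition $(f,F);(g,G)=(f;g,\langle\pi_1,(f\times1);G\rangle;F)$. $G:\mathcal E\mathrm{Lens}(\mathcal L)\to\mathcal E\mathrm{Dial}(\mathcal L)$ sends $\pi_1:A\times X\to A$ to $(A,X,1_{A\times X})$ and $(f,F)$ to $(f,F;\pi_2)$. **The first functor.** $\mathrm{ST\lambda C}_{\mathrm{cat}}\to\mathcal E\mathrm{Lens}(\mathbf P_{\mathrm{cat}})$ sends $A$ to the first projection $W(A)\times\mathcal M[C(A)]\to W(A)$ and $(z:A\vdash M:B)$ to $M^\bullet$ together with the span $W(A)\times\mathcal M[C(A)]\xleftarrow{\langle z^1,\,z^2\mathbin{>\!\!>\!=}M_z\{z^1/z\}\rangle}W(A)\times\mathcal M[C(B)]\xrightarrow{\langle M^\bullet\{z^1/z\},\,z^2\rangle}W(B)\times\mathcal M[C(B)]$. *)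

theory Defs
  imports Main
begin

section \<open>The simply typed lambda-calculus modulo beta-eta\<close>

text \<open>
  Terms are raw (unannotated) terms in de Bruijn notation, index 0 being the innermost variable;
  a context is the list of the types of the variables 0, 1, 2, \<dots>. Both calculi use parallel
  substitution. Equality is a typed judgement in context.
\<close>

datatype 'g ty = Gnd 'g | Arr "'g ty" "'g ty"

datatype tm = Var nat | Lam tm | App tm tm

definition up_ren :: "(nat \<Rightarrow> nat) \<Rightarrow> nat \<Rightarrow> nat" where
  "up_ren r = case_nat 0 (\<lambda>n. Suc (r n))"

primrec ren :: "tm \<Rightarrow> (nat \<Rightarrow> nat) \<Rightarrow> tm" where
  "ren (Var n) r = Var (r n)"
| "ren (Lam M) r = Lam (ren M (up_ren r))"
| "ren (App M N) r = App (ren M r) (ren N r)"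

definition up_sub :: "(nat \<Rightarrow> tm) \<Rightarrow> nat \<Rightarrow> tm" where
  "up_sub s = case_nat (Var 0) (\<lambda>n. ren (s n) Suc)"

primrec sub :: "tm \<Rightarrow> (nat \<Rightarrow> tm) \<Rightarrow> tm" where
  "sub (Var n) s = s n"
| "sub (Lam M) s = Lam (sub M (up_sub s))"
| "sub (App M N) s = App (sub M s) (sub N s)"

text \<open>
  \<open>inst M N\<close> substitutes \<open>N\<close> for variable 0 of \<open>M\<close> and lowers the other variables by one. When
  \<open>M\<close> lives in a context with the single variable \<open>x\<close>, it is \<open>M{N/x}\<close>, for \<open>N\<close> in any context.
\<close>

definition inst :: "tm \<Rightarrow> tm \<Rightarrow> tm" where
  "inst M N = sub M (case_nat N Var)"

inductive typed :: "'g ty list \<Rightarrow> tm \<Rightarrow> 'g ty \<Rightarrow> bool" where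
  Var: "n < length \<Gamma> \<Longrightarrow> typed \<Gamma> (Var n) (\<Gamma> ! n)"
| Lam: "typed (E # \<Gamma>) M F \<Longrightarrow> typed \<Gamma> (Lam M) (Arr E F)"
| App: "typed \<Gamma> M (Arr E F) \<Longrightarrow> typed \<Gamma> N E \<Longrightarrow> typed \<Gamma> (App M N) F"

inductive eqv :: "'g ty list \<Rightarrow> tm \<Rightarrow> tm \<Rightarrow> 'g ty \<Rightarrow> bool" where
  refl: "typed \<Gamma> M E \<Longrightarrow> eqv \<Gamma> M M E"
| sym: "eqv \<Gamma> M N E \<Longrightarrow> eqv \<Gamma> N M E"
| trans: "eqv \<Gamma> M N E \<Longrightarrow> eqv \<Gamma> N P E \<Longrightarrow> eqv \<Gamma> M P E"
| Lam: "eqv (E # \<Gamma>) M M' F \<Longrightarrow> eqv \<Gamma> (Lam M) (Lam M') (Arr E F)"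
| App: "eqv \<Gamma> M M' (Arr E F) \<Longrightarrow> eqv \<Gamma> N N' E \<Longrightarrow> eqv \<Gamma> (App M N) (App M' N') F"
| beta: "typed (E # \<Gamma>) M F \<Longrightarrow> typed \<Gamma> N E \<Longrightarrow> eqv \<Gamma> (App (Lam M) N) (inst M N) F"
| eta: "typed \<Gamma> M (Arr E F) \<Longrightarrow> eqv \<Gamma> (Lam (App (ren M Suc) (Var 0))) M (Arr E F)"


section \<open>The calculus P\<close>

text \<open>\<open>PM T\<close> is the monad type \<open>\<M>[T]\<close>.\<close>

datatype 'p pty = PGnd 'p | PArr "'p pty" "'p pty" | PProd "'p pty" "'p pty" | PM "'p pty"

datatype ptm =
    PVar nat
  | PLam ptm
  | PApp ptm ptm
  | PPair ptm ptm
  | PFst ptm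
  | PSnd ptm
  | PRet ptm
  | PBind ptm ptm
  | PZero
  | PPlus ptm ptm

primrec pren :: "ptm \<Rightarrow> (nat \<Rightarrow> nat) \<Rightarrow> ptm" where
  "pren (PVar n) r = PVar (r n)"
| "pren (PLam M) r = PLam (pren M (up_ren r))"
| "pren (PApp M N) r = PApp (pren M r) (pren N r)"
| "pren (PPair M N) r = PPair (pren M r) (pren N r)"
| "pren (PFst M) r = PFst (pren M r)"
| "pren (PSnd M) r = PSnd (pren M r)"
| "pren (PRet M) r = PRet (pren M r)"
| "pren (PBind M N) r = PBind (pren M r) (pren N r)"
| "pren PZero r = PZero"
| "pren (PPlus M N) r = PPlus (pren M r) (pren N r)"

abbreviation plift :: "ptm \<Rightarrow> ptm" where
  "plift M \<equiv> pren M Suc"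

definition up_psub :: "(nat \<Rightarrow> ptm) \<Rightarrow> nat \<Rightarrow> ptm" where
  "up_psub s = case_nat (PVar 0) (\<lambda>n. plift (s n))"

primrec psub :: "ptm \<Rightarrow> (nat \<Rightarrow> ptm) \<Rightarrow> ptm" where
  "psub (PVar n) s = s n"
| "psub (PLam M) s = PLam (psub M (up_psub s))"
| "psub (PApp M N) s = PApp (psub M s) (psub N s)"
| "psub (PPair M N) s = PPair (psub M s) (psub N s)"
| "psub (PFst M) s = PFst (psub M s)"
| "psub (PSnd M) s = PSnd (psub M s)"
| "psub (PRet M) s = PRet (psub M s)"
| "psub (PBind M N) s = PBind (psub M s) (psub N s)"
| "psub PZero s = PZero"
| "psub (PPlus M N) s = PPlus (psub M s) (psub N s)"

definition pinst :: "ptm \<Rightarrow> ptm \<Rightarrow> ptm" where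
  "pinst M N = psub M (case_nat N PVar)"

inductive ptyped :: "'p pty list \<Rightarrow> ptm \<Rightarrow> 'p pty \<Rightarrow> bool" where
  Var: "n < length \<Gamma> \<Longrightarrow> ptyped \<Gamma> (PVar n) (\<Gamma> ! n)"
| Lam: "ptyped (T # \<Gamma>) M U \<Longrightarrow> ptyped \<Gamma> (PLam M) (PArr T U)"
| App: "ptyped \<Gamma> M (PArr T U) \<Longrightarrow> ptyped \<Gamma> N T \<Longrightarrow> ptyped \<Gamma> (PApp M N) U"
| Pair: "ptyped \<Gamma> M T \<Longrightarrow> ptyped \<Gamma> N U \<Longrightarrow> ptyped \<Gamma> (PPair M N) (PProd T U)"
| Fst: "ptyped \<Gamma> M (PProd T U) \<Longrightarrow> ptyped \<Gamma> (PFst M) T"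
| Snd: "ptyped \<Gamma> M (PProd T U) \<Longrightarrow> ptyped \<Gamma> (PSnd M) U"
| Ret: "ptyped \<Gamma> M T \<Longrightarrow> ptyped \<Gamma> (PRet M) (PM T)"
| Bind: "ptyped \<Gamma> M (PM T) \<Longrightarrow> ptyped \<Gamma> N (PArr T (PM U)) \<Longrightarrow> ptyped \<Gamma> (PBind M N) (PM U)"
| Zero: "ptyped \<Gamma> PZero (PM T)"
| Plus: "ptyped \<Gamma> M (PM T) \<Longrightarrow> ptyped \<Gamma> N (PM T) \<Longrightarrow> ptyped \<Gamma> (PPlus M N) (PM T)"

inductive peqv :: "'p pty list \<Rightarrow> ptm \<Rightarrow> ptm \<Rightarrow> 'p pty \<Rightarrow> bool" where
  refl: "ptyped \<Gamma> M T \<Longrightarrow> peqv \<Gamma> M M T"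
| sym: "peqv \<Gamma> M N T \<Longrightarrow> peqv \<Gamma> N M T"
| trans: "peqv \<Gamma> M N T \<Longrightarrow> peqv \<Gamma> N P T \<Longrightarrow> peqv \<Gamma> M P T"
| Lam: "peqv (T # \<Gamma>) M M' U \<Longrightarrow> peqv \<Gamma> (PLam M) (PLam M') (PArr T U)"
| App: "peqv \<Gamma> M M' (PArr T U) \<Longrightarrow> peqv \<Gamma> N N' T \<Longrightarrow> peqv \<Gamma> (PApp M N) (PApp M' N') U"
| Pair: "peqv \<Gamma> M M' T \<Longrightarrow> peqv \<Gamma> N N' U \<Longrightarrow> peqv \<Gamma> (PPair M N) (PPair M' N') (PProd T U)"
| Fst: "peqv \<Gamma> M M' (PProd T U) \<Longrightarrow> peqv \<Gamma> (PFst M) (PFst M') T"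
| Snd: "peqv \<Gamma> M M' (PProd T U) \<Longrightarrow> peqv \<Gamma> (PSnd M) (PSnd M') U"
| Ret: "peqv \<Gamma> M M' T \<Longrightarrow> peqv \<Gamma> (PRet M) (PRet M') (PM T)"
| Bind: "peqv \<Gamma> M M' (PM T) \<Longrightarrow> peqv \<Gamma> N N' (PArr T (PM U))
    \<Longrightarrow> peqv \<Gamma> (PBind M N) (PBind M' N') (PM U)"
| Plus: "peqv \<Gamma> M M' (PM T) \<Longrightarrow> peqv \<Gamma> N N' (PM T)
    \<Longrightarrow> peqv \<Gamma> (PPlus M N) (PPlus M' N') (PM T)"
| beta: "ptyped (T # \<Gamma>) M U \<Longrightarrow> ptyped \<Gamma> N T \<Longrightarrow> peqv \<Gamma> (PApp (PLam M) N) (pinst M N) U"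
| eta: "ptyped \<Gamma> M (PArr T U) \<Longrightarrow> peqv \<Gamma> (PLam (PApp (plift M) (PVar 0))) M (PArr T U)"
| Fst_Pair: "ptyped \<Gamma> M T \<Longrightarrow> ptyped \<Gamma> N U \<Longrightarrow> peqv \<Gamma> (PFst (PPair M N)) M T"
| Snd_Pair: "ptyped \<Gamma> M T \<Longrightarrow> ptyped \<Gamma> N U \<Longrightarrow> peqv \<Gamma> (PSnd (PPair M N)) N U"
| surj_Pair: "ptyped \<Gamma> M (PProd T U) \<Longrightarrow> peqv \<Gamma> (PPair (PFst M) (PSnd M)) M (PProd T U)"
| Ret_Bind: "ptyped \<Gamma> M T \<Longrightarrow> ptyped \<Gamma> N (PArr T (PM U))
    \<Longrightarrow> peqv \<Gamma> (PBind (PRet M) N) (PApp N M) (PM U)"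
| Bind_Ret: "ptyped \<Gamma> M (PM T) \<Longrightarrow> peqv \<Gamma> (PBind M (PLam (PRet (PVar 0)))) M (PM T)"
| Bind_Bind: "ptyped \<Gamma> M (PM T) \<Longrightarrow> ptyped \<Gamma> N (PArr T (PM U)) \<Longrightarrow> ptyped \<Gamma> P (PArr U (PM V))
    \<Longrightarrow> peqv \<Gamma> (PBind (PBind M N) P)
          (PBind M (PLam (PBind (PApp (plift N) (PVar 0)) (plift P)))) (PM V)"
| Zero_Plus: "ptyped \<Gamma> M (PM T) \<Longrightarrow> peqv \<Gamma> (PPlus PZero M) M (PM T)"
| Plus_assoc: "ptyped \<Gamma> M (PM T) \<Longrightarrow> ptyped \<Gamma> N (PM T) \<Longrightarrow> ptyped \<Gamma> P (PM T)
    \<Longrightarrow> peqv \<Gamma> (PPlus (PPlus M N) P) (PPlus M (PPlus N P)) (PM T)"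
| Plus_commute: "ptyped \<Gamma> M (PM T) \<Longrightarrow> ptyped \<Gamma> N (PM T)
    \<Longrightarrow> peqv \<Gamma> (PPlus M N) (PPlus N M) (PM T)"
| Zero_Bind: "ptyped \<Gamma> N (PArr T (PM U)) \<Longrightarrow> peqv \<Gamma> (PBind PZero N) PZero (PM U)"
| Plus_Bind: "ptyped \<Gamma> M (PM T) \<Longrightarrow> ptyped \<Gamma> M' (PM T) \<Longrightarrow> ptyped \<Gamma> N (PArr T (PM U))
    \<Longrightarrow> peqv \<Gamma> (PBind (PPlus M M') N) (PPlus (PBind M N) (PBind M' N)) (PM U)"
| Bind_Zero: "ptyped \<Gamma> M (PM T) \<Longrightarrow> peqv \<Gamma> (PBind M (PLam PZero)) PZero (PM U)"
| Bind_Plus: "ptyped \<Gamma> M (PM T) \<Longrightarrow> ptyped (T # \<Gamma>) N (PM U) \<Longrightarrow> ptyped (T # \<Gamma>) N' (PM U)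
    \<Longrightarrow> peqv \<Gamma> (PBind M (PLam (PPlus N N'))) (PPlus (PBind M (PLam N)) (PBind M (PLam N'))) (PM U)"


section \<open>The Dialectica transformation\<close>

fun W_ty :: "('g \<Rightarrow> 'p) \<Rightarrow> ('g \<Rightarrow> 'p) \<Rightarrow> 'g ty \<Rightarrow> 'p pty"
  and C_ty :: "('g \<Rightarrow> 'p) \<Rightarrow> ('g \<Rightarrow> 'p) \<Rightarrow> 'g ty \<Rightarrow> 'p pty" where
  "W_ty gW gC (Gnd a) = PGnd (gW a)"
| "W_ty gW gC (Arr E F) = PProd (PArr (W_ty gW gC E) (W_ty gW gC F))
     (PArr (PProd (W_ty gW gC E) (C_ty gW gC F)) (PM (C_ty gW gC E)))"
| "C_ty gW gC (Gnd a) = PGnd (gC a)"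
| "C_ty gW gC (Arr E F) = PProd (W_ty gW gC E) (C_ty gW gC F)"

text \<open>
  \<open>bullet M\<close> is \<open>M\<^sup>\<bullet>\<close> and \<open>pull y M\<close> is \<open>M\<^sub>y\<close>, for \<open>y\<close> the index of a variable. In every
  \<open>\<lambda>\<pi>. \<dots>\<close> below, \<open>\<pi>\<close> is \<open>PVar 0\<close> and the subterms not containing \<open>\<pi>\<close> are lifted past it.
  The context of \<open>bullet M\<close> and \<open>pull y M\<close> is that of \<open>M\<close> with \<open>W\<close> applied to all types.
\<close>

fun bullet :: "tm \<Rightarrow> ptm"
  and pull :: "nat \<Rightarrow> tm \<Rightarrow> ptm" where
  "bullet (Var x) = PVar x"
| "bullet (Lam M) = PPair (PLam (bullet M))
     (PLam (PApp (PApp (plift (PLam (pull 0 M))) (PFst (PVar 0))) (PSnd (PVar 0))))"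
| "bullet (App P Q) = PApp (PFst (bullet P)) (bullet Q)"
| "pull y (Var x) = (if x = y then PLam (PRet (PVar 0)) else PLam PZero)"
| "pull y (Lam M) =
     PLam (PApp (PApp (plift (PLam (pull (Suc y) M))) (PFst (PVar 0))) (PSnd (PVar 0)))"
| "pull y (App P Q) =
     PLam (PPlus
       (PApp (plift (pull y P)) (PPair (plift (bullet Q)) (PVar 0)))
       (PBind (PApp (PSnd (plift (bullet P))) (PPair (plift (bullet Q)) (PVar 0)))
              (plift (pull y Q))))"


section \<open>Categories, binary products, functors\<close>

text \<open>
  Categories are given by families of hom-sets indexed by pairs of objects (not required to be
  disjoint), so identities, composition and the arrow part of a functor take the objects involved
  as arguments. \<open>Comp L A B C f g\<close> is the diagrammatic composite \<open>f;g\<close> of \<open>f : A \<rightarrow> B\<close> and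
  \<open>g : B \<rightarrow> C\<close>.
\<close>

record ('o, 'm) cat =
  Ob :: "'o set"
  Hom :: "'o \<Rightarrow> 'o \<Rightarrow> 'm set"
  Idn :: "'o \<Rightarrow> 'm"
  Comp :: "'o \<Rightarrow> 'o \<Rightarrow> 'o \<Rightarrow> 'm \<Rightarrow> 'm \<Rightarrow> 'm"

locale category =
  fixes L :: "('o, 'm, 'x) cat_scheme"
  assumes Idn_in_Hom: "A \<in> Ob L \<Longrightarrow> Idn L A \<in> Hom L A A"
    and Comp_in_Hom: "\<lbrakk>A \<in> Ob L; B \<in> Ob L; C \<in> Ob L; f \<in> Hom L A B; g \<in> Hom L B C\<rbrakk>
      \<Longrightarrow> Comp L A B C f g \<in> Hom L A C"
    and Idn_Comp: "\<lbrakk>A \<in> Ob L; B \<in> Ob L; f \<in> Hom L A B\<rbrakk> \<Longrightarrow> Comp L A A B (Idn L A) f = f"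
    and Comp_Idn: "\<lbrakk>A \<in> Ob L; B \<in> Ob L; f \<in> Hom L A B\<rbrakk> \<Longrightarrow> Comp L A B B f (Idn L B) = f"
    and Comp_assoc: "\<lbrakk>A \<in> Ob L; B \<in> Ob L; C \<in> Ob L; D \<in> Ob L;
        f \<in> Hom L A B; g \<in> Hom L B C; h \<in> Hom L C D\<rbrakk>
      \<Longrightarrow> Comp L A C D (Comp L A B C f g) h = Comp L A B D f (Comp L B C D g h)"

record ('o, 'm) prod_cat = "('o, 'm) cat" +
  Prod :: "'o \<Rightarrow> 'o \<Rightarrow> 'o"
  Pr1 :: "'o \<Rightarrow> 'o \<Rightarrow> 'm"
  Pr2 :: "'o \<Rightarrow> 'o \<Rightarrow> 'm"

locale category_with_products = category L
  for L :: "('o, 'm, 'x) prod_cat_scheme" +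
  assumes Prod_in_Ob: "\<lbrakk>A \<in> Ob L; B \<in> Ob L\<rbrakk> \<Longrightarrow> Prod L A B \<in> Ob L"
    and Pr1_in_Hom: "\<lbrakk>A \<in> Ob L; B \<in> Ob L\<rbrakk> \<Longrightarrow> Pr1 L A B \<in> Hom L (Prod L A B) A"
    and Pr2_in_Hom: "\<lbrakk>A \<in> Ob L; B \<in> Ob L\<rbrakk> \<Longrightarrow> Pr2 L A B \<in> Hom L (Prod L A B) B"
    and universal: "\<lbrakk>C \<in> Ob L; A \<in> Ob L; B \<in> Ob L; f \<in> Hom L C A; g \<in> Hom L C B\<rbrakk>
      \<Longrightarrow> \<exists>!h. h \<in> Hom L C (Prod L A B)
            \<and> Comp L C (Prod L A B) A h (Pr1 L A B) = f
            \<and> Comp L C (Prod L A B) B h (Pr2 L A B) = g"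

text \<open>\<open>tuple L C A B f g\<close> is \<open>\<langle>f, g\<rangle> : C \<rightarrow> A \<times> B\<close>; \<open>times_id L A B Y f\<close> is \<open>f \<times> 1 : A \<times> Y \<rightarrow> B \<times> Y\<close>.\<close>

definition tuple :: "('o, 'm, 'x) prod_cat_scheme \<Rightarrow> 'o \<Rightarrow> 'o \<Rightarrow> 'o \<Rightarrow> 'm \<Rightarrow> 'm \<Rightarrow> 'm" where
  "tuple L C A B f g = (THE h. h \<in> Hom L C (Prod L A B)
      \<and> Comp L C (Prod L A B) A h (Pr1 L A B) = f
      \<and> Comp L C (Prod L A B) B h (Pr2 L A B) = g)"

definition times_id :: "('o, 'm, 'x) prod_cat_scheme \<Rightarrow> 'o \<Rightarrow> 'o \<Rightarrow> 'o \<Rightarrow> 'm \<Rightarrow> 'm" where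
  "times_id L A B Y f =
     tuple L (Prod L A Y) B Y (Comp L (Prod L A Y) A B (Pr1 L A Y) f) (Pr2 L A Y)"

record ('o, 'm, 'o2, 'm2) fctr =
  on_ob :: "'o \<Rightarrow> 'o2"
  on_arr :: "'o \<Rightarrow> 'o \<Rightarrow> 'm \<Rightarrow> 'm2"

locale is_functor = src: category L + tgt: category K
  for L :: "('o, 'm, 'x) cat_scheme"
    and K :: "('o2, 'm2, 'y) cat_scheme"
    and F :: "('o, 'm, 'o2, 'm2) fctr" +
  assumes on_ob_in_Ob: "A \<in> Ob L \<Longrightarrow> on_ob F A \<in> Ob K"
    and on_arr_in_Hom: "\<lbrakk>A \<in> Ob L; B \<in> Ob L; f \<in> Hom L A B\<rbrakk>
      \<Longrightarrow> on_arr F A B f \<in> Hom K (on_ob F A) (on_ob F B)"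
    and on_arr_Idn: "A \<in> Ob L \<Longrightarrow> on_arr F A A (Idn L A) = Idn K (on_ob F A)"
    and on_arr_Comp: "\<lbrakk>A \<in> Ob L; B \<in> Ob L; C \<in> Ob L; f \<in> Hom L A B; g \<in> Hom L B C\<rbrakk>
      \<Longrightarrow> on_arr F A C (Comp L A B C f g) =
          Comp K (on_ob F A) (on_ob F B) (on_ob F C) (on_arr F A B f) (on_arr F B C g)"

definition functor_comp ::
  "('o, 'm, 'o2, 'm2) fctr \<Rightarrow> ('o2, 'm2, 'o3, 'm3) fctr \<Rightarrow> ('o, 'm, 'o3, 'm3) fctr" where
  "functor_comp F G = \<lparr>
     on_ob = (\<lambda>A. on_ob G (on_ob F A)),
     on_arr = (\<lambda>A B f. on_arr G (on_ob F A) (on_ob F B) (on_arr F A B f))\<rparr>"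


section \<open>The syntactic categories\<close>

text \<open>
  \<open>cls A M B\<close> is the class of \<open>z : A \<turnstile> M : B\<close>, where \<open>z\<close> is variable 0 of a one-variable context.
  It is empty unless \<open>M\<close> has type \<open>B\<close> there. Operations on classes are unions over all
  representatives, so that no representative has to be chosen.
\<close>

definition cls :: "'g ty \<Rightarrow> tm \<Rightarrow> 'g ty \<Rightarrow> tm set" where
  "cls A M B = {N. eqv [A] M N B}"

definition STLC_cat :: "('g ty, tm set) cat" where
  "STLC_cat = \<lparr>
     Ob = UNIV,
     Hom = (\<lambda>A B. {cls A M B | M. typed [A] M B}),
     Idn = (\<lambda>A. cls A (Var 0) A),
     Comp = (\<lambda>A B C f g. \<Union>M\<in>f. \<Union>N\<in>g. cls A (inst N M) C)\<rparr>"

definition pcls :: "'p pty \<Rightarrow> ptm \<Rightarrow> 'p pty \<Rightarrow> ptm set" where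
  "pcls A M B = {N. peqv [A] M N B}"

definition P_cat :: "('p pty, ptm set) prod_cat" where
  "P_cat = \<lparr>
     Ob = UNIV,
     Hom = (\<lambda>A B. {pcls A M B | M. ptyped [A] M B}),
     Idn = (\<lambda>A. pcls A (PVar 0) A),
     Comp = (\<lambda>A B C f g. \<Union>M\<in>f. \<Union>N\<in>g. pcls A (pinst N M) C),
     Prod = PProd,
     Pr1 = (\<lambda>A B. pcls (PProd A B) (PFst (PVar 0)) A),
     Pr2 = (\<lambda>A B. pcls (PProd A B) (PSnd (PVar 0)) B)\<rparr>"


section \<open>Euclidean lenses and the Euclidean Dialectica category\<close>

text \<open>
  The first projection \<open>\<pi>\<^sub>1 : A \<times> X \<rightarrow> A\<close> is the triple \<open>(A, X, \<pi>\<^sub>1)\<close>, since the arrow \<open>\<pi>\<^sub>1\<close> alone need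
  not determine \<open>A\<close> and \<open>X\<close>. An arrow of lenses is \<open>(f, (F, R))\<close>, where \<open>(F, R)\<close> is the span with
  left leg \<open>F\<close> and right leg \<open>R = f \<times> 1\<close>.
\<close>

definition ELens ::
  "('o, 'm, 'x) prod_cat_scheme \<Rightarrow> ('o \<times> 'o \<times> 'm, 'm \<times> ('m \<times> 'm)) cat" where
  "ELens L = \<lparr>
     Ob = {(A, X, Pr1 L A X) | A X. A \<in> Ob L \<and> X \<in> Ob L},
     Hom = (\<lambda>(A, X, _) (B, Y, _). {(f, (F, R)).
        f \<in> Hom L A B \<and>
        F \<in> Hom L (Prod L A Y) (Prod L A X) \<and>
        R = times_id L A B Y f \<and>
        Comp L (Prod L A Y) (Prod L A X) A F (Pr1 L A X) = Pr1 L A Y}),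
     Idn = (\<lambda>(A, X, _). (Idn L A, (Idn L (Prod L A X), Idn L (Prod L A X)))),
     Comp = (\<lambda>(A, X, _) (B, Y, _) (C, Z, _) (f, (F, _)) (g, (G, _)).
       let fg = Comp L A B C f g;
           GY = Comp L (Prod L A Z) (Prod L B Z) Y (times_id L A B Z f)
                  (Comp L (Prod L B Z) (Prod L B Y) Y G (Pr2 L B Y))
       in (fg,
           (Comp L (Prod L A Z) (Prod L A Y) (Prod L A X)
              (tuple L (Prod L A Z) A Y (Pr1 L A Z) GY) F,
            times_id L A C Z fg)))\<rparr>"

definition EDial ::
  "('o, 'm, 'x) prod_cat_scheme \<Rightarrow> ('o \<times> 'o \<times> 'm, 'm \<times> 'm) cat" where
  "EDial L = \<lparr>
     Ob = {(A, X, Idn L (Prod L A X)) | A X. A \<in> Ob L \<and> X \<in> Ob L},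
     Hom = (\<lambda>(A, X, _) (B, Y, _). Hom L A B \<times> Hom L (Prod L A Y) X),
     Idn = (\<lambda>(A, X, _). (Idn L A, Pr2 L A X)),
     Comp = (\<lambda>(A, X, _) (B, Y, _) (C, Z, _) (f, F) (g, G).
       (Comp L A B C f g,
        Comp L (Prod L A Z) (Prod L A Y) X
          (tuple L (Prod L A Z) A Y (Pr1 L A Z)
             (Comp L (Prod L A Z) (Prod L B Z) Y (times_id L A B Z f) G))
          F))\<rparr>"

definition ELens_to_EDial ::
  "('o, 'm, 'x) prod_cat_scheme \<Rightarrow> ('o \<times> 'o \<times> 'm, 'm \<times> ('m \<times> 'm), 'o \<times> 'o \<times> 'm, 'm \<times> 'm) fctr"
where
  "ELens_to_EDial L = \<lparr>
     on_ob = (\<lambda>(A, X, _). (A, X, Idn L (Prod L A X))),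
     on_arr = (\<lambda>(A, X, _) (B, Y, _) (f, (F, _)).
       (f, Comp L (Prod L A Y) (Prod L A X) X F (Pr2 L A X)))\<rparr>"

text \<open>Below, \<open>PVar 0\<close> is the variable \<open>z\<close>, so that \<open>pinst N (PFst (PVar 0))\<close> is \<open>N{z\<^sup>1/z}\<close>.\<close>

definition STLC_to_ELens ::
  "('g \<Rightarrow> 'p) \<Rightarrow> ('g \<Rightarrow> 'p) \<Rightarrow>
   ('g ty, tm set, 'p pty \<times> 'p pty \<times> ptm set, ptm set \<times> (ptm set \<times> ptm set)) fctr" where
  "STLC_to_ELens gW gC = (let W = W_ty gW gC; C = C_ty gW gC in \<lparr>
     on_ob = (\<lambda>A. (W A, PM (C A), Pr1 P_cat (W A) (PM (C A)))),
     on_arr = (\<lambda>A B f.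
       (\<Union>M\<in>f. pcls (W A) (bullet M) (W B),
        (\<Union>M\<in>f. pcls (PProd (W A) (PM (C B)))
            (PPair (PFst (PVar 0))
                   (PBind (PSnd (PVar 0)) (pinst (pull 0 M) (PFst (PVar 0)))))
            (PProd (W A) (PM (C A))),
         \<Union>M\<in>f. pcls (PProd (W A) (PM (C B)))
            (PPair (pinst (bullet M) (PFst (PVar 0))) (PSnd (PVar 0)))
            (PProd (W B) (PM (C B))))))\<rparr>)"

definition STLC_to_EDial ::
  "('g \<Rightarrow> 'p) \<Rightarrow> ('g \<Rightarrow> 'p) \<Rightarrow>
   ('g ty, tm set, 'p pty \<times> 'p pty \<times> ptm set, ptm set \<times> ptm set) fctr" where
  "STLC_to_EDial gW gC = functor_comp (STLC_to_ELens gW gC) (ELens_to_EDial P_cat)"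

end

theory Submission
  imports Defs
begin

text \<open>
The pair \<open>(bullet M, pull 0 M)\<close> is a derivative: \<open>pull y M\<close> is the linear, effectful map that
sends an opponent \<open>\<pi> : C(B)\<close> of the result to the multiset of opponents that \<open>M\<close> directs against
its variable \<open>y\<close>. The whole statement rests on the chain rule for this derivative,
  \<open>(M{s})\<^sub>y = \<lambda>\<pi>. \<Sum>\<^sub>x (M\<^sub>x{s\<^sup>\<bullet>} \<pi> >>= (s x)\<^sub>y)\<close>,
together with \<open>(M{s})\<^sup>\<bullet> = M\<^sup>\<bullet>{s\<^sup>\<bullet>}\<close>, where \<open>x\<close> ranges over the variables of the context of \<open>M\<close>;
this is the lemma \<open>chain_rule\<close>. It has two uses.

First, for the substitution that replaces one variable, the chain rule says precisely that the
translation validates \<open>\<beta>\<close>; since \<open>\<eta>\<close> is a direct computation, the translation maps \<open>\<beta>\<eta>\<close>-equal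
terms to equal terms (\<open>dialectica_sound\<close>), so that the functor is well defined on classes.
Secondly, for a one-variable context the sum has one term and the rule reads
\<open>(N{M})\<^sub>x = \<lambda>\<pi>. (N\<^sub>x{M\<^sup>\<bullet>} \<pi> >>= M\<^sub>x)\<close>. By associativity of bind, this turns composition of terms into
composition of lenses (\<open>lens_put_inst\<close>); the unit laws of the monad handle identities.

The passage from lenses to the Euclidean Dialectica category is a fact about an arbitrary category
with binary products. The left leg \<open>F\<close> of a lens satisfies \<open>F;\<pi>\<^sub>1 = \<pi>\<^sub>1\<close>, so it is determined by
\<open>F;\<pi>\<^sub>2\<close>: the functor is faithful, and the category laws of lenses are inherited from those
of the Euclidean Dialectica category (\<open>faithful_imp_is_functor\<close>).

Equality in P is a typed judgement on raw terms, which would burden every computation with typing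
side conditions. They are avoided by a directed rewrite relation \<open>\<leadsto>\<close> on raw terms all of whose
steps preserve types (\<open>red_peqv\<close>): two well-typed terms with a common reduct are equal, and only
the two end points of a computation have to be typed.
\<close>

section \<open>Calculus of renamings and substitutions\<close>

lemma up_ren_simps [simp]: "up_ren r 0 = 0" "up_ren r (Suc n) = Suc (r n)"
  by (simp_all add: up_ren_def)

lemma up_sub_simps [simp]: "up_sub s 0 = Var 0" "up_sub s (Suc n) = ren (s n) Suc"
  by (simp_all add: up_sub_def)

lemma up_psub_simps [simp]: "up_psub s 0 = PVar 0" "up_psub s (Suc n) = plift (s n)"
  by (simp_all add: up_psub_def)

lemma up_ren_comp: "up_ren (\<lambda>n. r' (r n)) = (\<lambda>n. up_ren r' (up_ren r n))"
  by (rule ext) (simp add: up_ren_def split: nat.split)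

text \<open>
The order of the fusion laws matters: under a binder a substituted term is itself renamed, so
\<open>ren_sub\<close> builds on \<open>ren_ren\<close>, and \<open>sub_sub\<close> on the two mixed laws.
\<close>

lemma ren_ren: "ren (ren M r) r' = ren M (\<lambda>n. r' (r n))"
  by (induction M arbitrary: r r') (simp_all add: up_ren_comp)

lemma up_sub_up_ren: "(\<lambda>n. up_sub s (up_ren r n)) = up_sub (\<lambda>n. s (r n))"
  by (rule ext) (simp add: up_ren_def up_sub_def split: nat.split)

lemma sub_ren: "sub (ren M r) s = sub M (\<lambda>n. s (r n))"
  by (induction M arbitrary: r s) (simp_all add: up_sub_up_ren)

lemma ren_up_sub: "(\<lambda>n. ren (up_sub s n) (up_ren r)) = up_sub (\<lambda>n. ren (s n) r)"
  by (rule ext) (simp add: up_sub_def ren_ren split: nat.split)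

lemma ren_sub: "ren (sub M s) r = sub M (\<lambda>n. ren (s n) r)"
  by (induction M arbitrary: r s) (simp_all add: ren_up_sub)

lemma sub_up_sub: "(\<lambda>n. sub (up_sub s n) (up_sub t)) = up_sub (\<lambda>n. sub (s n) t)"
  by (rule ext) (simp add: up_sub_def sub_ren ren_sub split: nat.split)

lemma sub_sub: "sub (sub M s) t = sub M (\<lambda>n. sub (s n) t)"
  by (induction M arbitrary: s t) (simp_all add: sub_up_sub)

lemma up_sub_Var: "up_sub Var = Var"
  by (rule ext) (simp add: up_sub_def split: nat.split)

lemma sub_Var [simp]: "sub M Var = M"
  by (induction M) (simp_all add: up_sub_Var)

lemma pren_pren: "pren (pren M r) r' = pren M (\<lambda>n. r' (r n))"
  by (induction M arbitrary: r r') (simp_all add: up_ren_comp)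

lemma up_psub_up_ren: "(\<lambda>n. up_psub s (up_ren r n)) = up_psub (\<lambda>n. s (r n))"
  by (rule ext) (simp add: up_ren_def up_psub_def split: nat.split)

lemma psub_pren: "psub (pren M r) s = psub M (\<lambda>n. s (r n))"
  by (induction M arbitrary: r s) (simp_all add: up_psub_up_ren)

lemma pren_up_psub: "(\<lambda>n. pren (up_psub s n) (up_ren r)) = up_psub (\<lambda>n. pren (s n) r)"
  by (rule ext) (simp add: up_psub_def pren_pren split: nat.split)

lemma pren_psub: "pren (psub M s) r = psub M (\<lambda>n. pren (s n) r)"
  by (induction M arbitrary: r s) (simp_all add: pren_up_psub)

lemma psub_up_psub: "(\<lambda>n. psub (up_psub s n) (up_psub t)) = up_psub (\<lambda>n. psub (s n) t)"
  by (rule ext) (simp add: up_psub_def psub_pren pren_psub split: nat.split)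

lemma psub_psub: "psub (psub M s) t = psub M (\<lambda>n. psub (s n) t)"
  by (induction M arbitrary: s t) (simp_all add: psub_up_psub)

lemma up_psub_PVar: "up_psub PVar = PVar"
  by (rule ext) (simp add: up_psub_def split: nat.split)

lemma psub_PVar [simp]: "psub M PVar = M"
  by (induction M) (simp_all add: up_psub_PVar)

lemma pren_as_psub: "pren M r = psub M (\<lambda>n. PVar (r n))"
  using psub_pren[of M r PVar] by simp

lemma pren_up_plift [simp]: "pren (plift M) (up_ren r) = plift (pren M r)"
  by (simp add: pren_pren)

lemma psub_up_plift [simp]: "psub (plift M) (up_psub s) = plift (psub M s)"
  by (simp add: psub_pren pren_psub)

lemma pinst_plift [simp]: "pinst (plift M) N = M"
  by (simp add: pinst_def psub_pren)

section \<open>Typing and equality of lambda-terms in context\<close>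

lemma typed_ren:
  assumes "typed \<Gamma> M E" "\<And>n. n < length \<Gamma> \<Longrightarrow> r n < length \<Delta> \<and> \<Delta> ! r n = \<Gamma> ! n"
  shows "typed \<Delta> (ren M r) E"
  using assms
proof (induction arbitrary: \<Delta> r)
  case (Var n \<Gamma>)
  then show ?case using typed.Var[of "r n" \<Delta>] by auto
next
  case (Lam E \<Gamma> M F)
  have "typed (E # \<Delta>) (ren M (up_ren r)) F"
    by (rule Lam.IH) (auto simp: Lam.prems nth_Cons up_ren_def split: nat.splits)
  then show ?case by (simp add: typed.Lam)
qed (simp_all, (blast intro: typed.App)+)

lemma typed_sub:
  assumes "typed \<Gamma> M E" "\<And>n. n < length \<Gamma> \<Longrightarrow> typed \<Delta> (s n) (\<Gamma> ! n)"
  shows "typed \<Delta> (sub M s) E"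
  using assms
proof (induction arbitrary: \<Delta> s)
  case (Lam E \<Gamma> M F)
  have "typed (E # \<Delta>) (sub M (up_sub s)) F"
  proof (rule Lam.IH)
    fix n assume "n < length (E # \<Gamma>)"
    then show "typed (E # \<Delta>) (up_sub s n) ((E # \<Gamma>) ! n)"
      using typed.Var[of 0 "E # \<Delta>"]
      by (cases n) (auto intro!: typed_ren Lam.prems)
  qed
  then show ?case by (simp add: typed.Lam)
qed (simp_all, (blast intro: typed.App)+)

text \<open>
A typed term has no free variables beyond its context. This is what makes \<open>inst\<close>, which also lowers
the variables from 1 on, compose as substitution does in a category of one-variable contexts.
\<close>

lemma sub_cong_typed:
  assumes "typed \<Gamma> M E" "\<And>n. n < length \<Gamma> \<Longrightarrow> s n = t n"
  shows "sub M s = sub M t"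
  using assms
proof (induction arbitrary: s t)
  case (Lam E \<Gamma> M F)
  have "sub M (up_sub s) = sub M (up_sub t)"
    by (rule Lam.IH) (auto simp: Lam.prems up_sub_def split: nat.splits)
  then show ?case by simp
qed (metis sub.simps)+

text \<open>
Appending to the end of the context shifts no index, so that the term is unchanged.
\<close>

lemma typed_weaken: "typed \<Gamma> M E \<Longrightarrow> typed (\<Gamma> @ \<Delta>) M E"
proof (induction rule: typed.induct)
  case (Var n \<Gamma>)
  then show ?case using typed.Var[of n "\<Gamma> @ \<Delta>"] by (simp add: nth_append)
qed (auto intro: typed.intros)

lemma typed_inst:
  assumes "typed (E # \<Gamma>) M F" "typed \<Gamma> N E"
  shows "typed \<Gamma> (inst M N) F"
  unfolding inst_def
proof (rule typed_sub[OF assms(1)])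
  fix n assume "n < length (E # \<Gamma>)"
  then show "typed \<Gamma> (case_nat N Var n) ((E # \<Gamma>) ! n)"
    using assms(2) by (cases n) (auto intro: typed.Var)
qed

lemma eqv_typed: "eqv \<Gamma> M N E \<Longrightarrow> typed \<Gamma> M E \<and> typed \<Gamma> N E"
proof (induction rule: eqv.induct)
  case (eta \<Gamma> M E F)
  have "typed (E # \<Gamma>) (ren M Suc) (Arr E F)" by (rule typed_ren[OF eta]) auto
  moreover have "typed (E # \<Gamma>) (Var 0) E" using typed.Var[of 0 "E # \<Gamma>"] by simp
  ultimately show ?case using eta by (auto intro: typed.intros)
qed (auto intro: typed.intros typed_inst)

lemma eqv_weaken: "eqv \<Gamma> M N E \<Longrightarrow> eqv (\<Gamma> @ \<Delta>) M N E"
proof (induction rule: eqv.induct)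
  case (beta E \<Gamma> M F N)
  have "typed (E # (\<Gamma> @ \<Delta>)) M F" using typed_weaken[OF beta(1), of \<Delta>] by simp
  then show ?case by (rule eqv.beta[OF _ typed_weaken[OF beta(2)]])
qed (auto intro: eqv.intros typed_weaken)

text \<open>
Both sides are contracta of \<open>\<beta>\<close>-redexes, and redexes respect equality by the congruence rules;
this spares a proof that equality is stable under parallel substitution.
\<close>

lemma eqv_inst:
  assumes "eqv [B] M M' C" "eqv \<Gamma> N N' B"
  shows "eqv \<Gamma> (inst M N) (inst M' N') C"
proof -
  have M: "eqv (B # \<Gamma>) M M' C" using eqv_weaken[OF assms(1), of \<Gamma>] by simp
  have "eqv \<Gamma> (App (Lam M) N) (App (Lam M') N') C" by (rule eqv.App[OF eqv.Lam[OF M] assms(2)])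
  moreover have "eqv \<Gamma> (App (Lam M) N) (inst M N) C" "eqv \<Gamma> (App (Lam M') N') (inst M' N') C"
    using eqv_typed[OF M] eqv_typed[OF assms(2)] by (auto intro: eqv.beta)
  ultimately show ?thesis by (meson eqv.sym eqv.trans)
qed

section \<open>Typing and equality of P-terms in context\<close>

inductive_cases ptyped_VarE [elim!]: "ptyped \<Gamma> (PVar n) T"
inductive_cases ptyped_LamE [elim!]: "ptyped \<Gamma> (PLam M) T"
inductive_cases ptyped_AppE [elim!]: "ptyped \<Gamma> (PApp M N) T"
inductive_cases ptyped_PairE [elim!]: "ptyped \<Gamma> (PPair M N) T"
inductive_cases ptyped_FstE [elim!]: "ptyped \<Gamma> (PFst M) T"
inductive_cases ptyped_SndE [elim!]: "ptyped \<Gamma> (PSnd M) T"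
inductive_cases ptyped_RetE [elim!]: "ptyped \<Gamma> (PRet M) T"
inductive_cases ptyped_BindE [elim!]: "ptyped \<Gamma> (PBind M N) T"
inductive_cases ptyped_ZeroE [elim!]: "ptyped \<Gamma> PZero T"
inductive_cases ptyped_PlusE [elim!]: "ptyped \<Gamma> (PPlus M N) T"

lemma ptyped_Var': "n < length \<Gamma> \<Longrightarrow> T = \<Gamma> ! n \<Longrightarrow> ptyped \<Gamma> (PVar n) T"
  by (simp add: ptyped.Var)

lemma ptyped_pren:
  assumes "ptyped \<Gamma> M T" "\<And>n. n < length \<Gamma> \<Longrightarrow> r n < length \<Delta> \<and> \<Delta> ! r n = \<Gamma> ! n"
  shows "ptyped \<Delta> (pren M r) T"
  using assms
proof (induction arbitrary: \<Delta> r)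
  case (Lam T \<Gamma> M U)
  have "ptyped (T # \<Delta>) (pren M (up_ren r)) U"
    by (rule Lam.IH) (auto simp: Lam.prems nth_Cons up_ren_def split: nat.splits)
  then show ?case by (simp add: ptyped.Lam)
qed (simp_all add: ptyped_Var', (blast intro: ptyped.intros)+)

lemma ptyped_plift: "ptyped \<Gamma> M T \<Longrightarrow> ptyped (U # \<Gamma>) (plift M) T"
  by (erule ptyped_pren) auto

lemma ptyped_psub:
  assumes "ptyped \<Gamma> M T" "\<And>n. n < length \<Gamma> \<Longrightarrow> ptyped \<Delta> (s n) (\<Gamma> ! n)"
  shows "ptyped \<Delta> (psub M s) T"
  using assms
proof (induction arbitrary: \<Delta> s)
  case (Lam T \<Gamma> M U)
  have "ptyped (T # \<Delta>) (psub M (up_psub s)) U"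
  proof (rule Lam.IH)
    fix n assume "n < length (T # \<Gamma>)"
    then show "ptyped (T # \<Delta>) (up_psub s n) ((T # \<Gamma>) ! n)"
      by (cases n) (auto intro!: ptyped_plift Lam.prems ptyped_Var')
  qed
  then show ?case by (simp add: ptyped.Lam)
qed (simp_all, (blast intro: ptyped.intros)+)

lemma psub_cong_typed:
  assumes "ptyped \<Gamma> M T" "\<And>n. n < length \<Gamma> \<Longrightarrow> s n = t n"
  shows "psub M s = psub M t"
  using assms
proof (induction arbitrary: s t)
  case (Lam T \<Gamma> M U)
  have "psub M (up_psub s) = psub M (up_psub t)"
    by (rule Lam.IH) (auto simp: Lam.prems up_psub_def split: nat.splits)
  then show ?case by simp
next
  case (Var n \<Gamma>)
  then show ?case by simp
next
  case (App \<Gamma> M T U N)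
  show ?case using App.IH[of s t] App.prems by simp
next
  case (Pair \<Gamma> M T N U)
  show ?case using Pair.IH[of s t] Pair.prems by simp
next
  case (Fst \<Gamma> M T U)
  show ?case using Fst.IH[of s t] Fst.prems by simp
next
  case (Snd \<Gamma> M T U)
  show ?case using Snd.IH[of s t] Snd.prems by simp
next
  case (Ret \<Gamma> M T)
  show ?case using Ret.IH[of s t] Ret.prems by simp
next
  case (Bind \<Gamma> M T N U)
  show ?case using Bind.IH[of s t] Bind.prems by simp
next
  case (Zero \<Gamma> T)
  show ?case by simp
next
  case (Plus \<Gamma> M T N)
  show ?case using Plus.IH[of s t] Plus.prems by simp
qed

lemma ptyped_weaken: "ptyped \<Gamma> M T \<Longrightarrow> ptyped (\<Gamma> @ \<Delta>) M T"
proof (induction rule: ptyped.induct)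
  case (Var n \<Gamma>)
  then show ?case by (auto intro!: ptyped_Var' simp add: nth_append)
qed (simp_all, (blast intro: ptyped.intros)+)

lemma ptyped_pinst:
  assumes "ptyped (T # \<Gamma>) M U" "ptyped \<Gamma> N T"
  shows "ptyped \<Gamma> (pinst M N) U"
  unfolding pinst_def
proof (rule ptyped_psub[OF assms(1)])
  fix n assume "n < length (T # \<Gamma>)"
  then show "ptyped \<Gamma> (case_nat N PVar n) ((T # \<Gamma>) ! n)"
    using assms(2) by (cases n) (auto intro: ptyped.Var)
qed

lemma ptyped_pinst1:
  "ptyped [T] M U \<Longrightarrow> ptyped \<Gamma> N T \<Longrightarrow> ptyped \<Gamma> (pinst M N) U"
  using ptyped_weaken[of "[T]" M U \<Gamma>] by (simp add: ptyped_pinst)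

text \<open>
Types of raw terms are not unique, but a typing of a renamed term is a typing of the
term itself. Hence \<open>\<eta>\<close>-contraction and rewriting below a lifting preserve types.
\<close>

lemma ptyped_strengthen:
  assumes "ptyped \<Delta> (pren M r) T" "\<And>n. r n < length \<Delta> \<Longrightarrow> n < length \<Gamma> \<and> \<Gamma> ! n = \<Delta> ! r n"
  shows "ptyped \<Gamma> M T"
  using assms
proof (induction M arbitrary: \<Gamma> \<Delta> r T)
  case (PLam M)
  from PLam.prems(1) obtain E F where T: "T = PArr E F" "ptyped (E # \<Delta>) (pren M (up_ren r)) F"
    by auto
  have "ptyped (E # \<Gamma>) M F"
    by (rule PLam.IH[OF T(2)]) (auto simp: PLam.prems nth_Cons up_ren_def split: nat.splits)
  then show ?case using T by (simp add: ptyped.Lam)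
next
  case (PVar n)
  then show ?case by (auto intro!: ptyped_Var')
next
  case (PApp M N)
  then show ?case unfolding pren.simps by (elim ptyped_AppE) (blast intro: ptyped.App)
next
  case (PBind M N)
  then show ?case unfolding pren.simps by (elim ptyped_BindE) (blast intro: ptyped.Bind)
next
  case (PPair M N)
  then show ?case unfolding pren.simps by (elim ptyped_PairE) (blast intro: ptyped.Pair)
next
  case (PPlus M N)
  then show ?case unfolding pren.simps by (elim ptyped_PlusE) (blast intro: ptyped.Plus)
next
  case (PFst M)
  then show ?case unfolding pren.simps by (elim ptyped_FstE) (blast intro: ptyped.Fst)
next
  case (PSnd M)
  then show ?case unfolding pren.simps by (elim ptyped_SndE) (blast intro: ptyped.Snd)
next
  case (PRet M)
  then show ?case unfolding pren.simps by (elim ptyped_RetE) (blast intro: ptyped.Ret)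
next
  case PZero
  then show ?case unfolding pren.simps by (elim ptyped_ZeroE) (blast intro: ptyped.Zero)
qed

lemma ptyped_plift_iff: "ptyped (U # \<Gamma>) (plift M) T \<longleftrightarrow> ptyped \<Gamma> M T"
proof
  assume "ptyped (U # \<Gamma>) (plift M) T"
  then show "ptyped \<Gamma> M T" by (rule ptyped_strengthen) simp
qed (rule ptyped_plift)

lemma ptyped_PVar0: "ptyped (T # \<Gamma>) (PVar 0) T"
  by (simp add: ptyped_Var')

lemmas ptyped_rules = ptyped_PVar0 ptyped_plift ptyped.Lam ptyped.App ptyped.Pair ptyped.Fst
  ptyped.Snd ptyped.Ret ptyped.Bind ptyped.Zero ptyped.Plus

lemma peqv_typed: "peqv \<Gamma> M N T \<Longrightarrow> ptyped \<Gamma> M T \<and> ptyped \<Gamma> N T"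
proof (induction rule: peqv.induct)
  case (sym \<Gamma> M N T)
  then show ?case by simp
next
  case (trans \<Gamma> M N T P)
  then show ?case by simp
qed (((elim conjE)?, rule conjI, ((assumption | rule ptyped_rules ptyped_pinst)+)[1], ((assumption | rule ptyped_rules ptyped_pinst)+)[1])+)

lemma pren_pinst: "pren (pinst M N) r = pinst (pren M (up_ren r)) (pren N r)"
proof -
  have "(\<lambda>n. pren (case_nat N PVar n) r) = (\<lambda>n. case_nat (pren N r) PVar (up_ren r n))"
    by (rule ext) (simp add: up_ren_def split: nat.split)
  then show ?thesis by (simp add: pinst_def pren_psub psub_pren)
qed

lemma peqv_weaken: "peqv \<Gamma> M N T \<Longrightarrow> peqv (\<Gamma> @ \<Delta>) M N T"
proof (induction rule: peqv.induct)
  case (beta T \<Gamma> M U N)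
  have "ptyped (T # (\<Gamma> @ \<Delta>)) M U" using ptyped_weaken[OF beta(1), of \<Delta>] by simp
  then show ?case by (rule peqv.beta[OF _ ptyped_weaken[OF beta(2)]])
next
  case (Bind_Plus \<Gamma> M T N U N')
  have "ptyped (T # (\<Gamma> @ \<Delta>)) N (PM U)" "ptyped (T # (\<Gamma> @ \<Delta>)) N' (PM U)"
    using ptyped_weaken[OF Bind_Plus(2), of \<Delta>] ptyped_weaken[OF Bind_Plus(3), of \<Delta>] by simp_all
  then show ?case by (rule peqv.Bind_Plus[OF ptyped_weaken[OF Bind_Plus(1)]])
next
  case (sym \<Gamma> M N T)
  then show ?case by (blast intro: peqv.sym)
next
  case (trans \<Gamma> M N T P)
  then show ?case by (blast intro: peqv.trans)
next
  case (Lam T \<Gamma> M M' U)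
  then show ?case by (simp add: peqv.Lam)
qed (assumption | rule peqv.intros(1,5-25) ptyped_weaken)+

lemma peqv_pren:
  assumes "peqv \<Gamma> M N T" "\<And>n. n < length \<Gamma> \<Longrightarrow> r n < length \<Delta> \<and> \<Delta> ! r n = \<Gamma> ! n"
  shows "peqv \<Delta> (pren M r) (pren N r) T"
  using assms
proof (induction arbitrary: \<Delta> r)
  case (sym \<Gamma> M N T)
  then show ?case by (blast intro: peqv.sym)
next
  case (trans \<Gamma> M N T P)
  then show ?case by (blast intro: peqv.trans)
next
  case (Lam T \<Gamma> M M' U)
  have "peqv (T # \<Delta>) (pren M (up_ren r)) (pren M' (up_ren r)) U"
    by (rule Lam.IH) (auto simp: Lam.prems nth_Cons up_ren_def split: nat.splits)
  then show ?case by (simp add: peqv.Lam)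
next
  case (beta T \<Gamma> M U N)
  have "ptyped (T # \<Delta>) (pren M (up_ren r)) U"
    by (rule ptyped_pren[OF beta(1)]) (auto simp: beta.prems nth_Cons up_ren_def split: nat.splits)
  then show ?case
    using peqv.beta ptyped_pren[OF beta(2) beta.prems] by (simp add: pren_pinst)
next
  case (Bind_Plus \<Gamma> M T N U N')
  have "ptyped (T # \<Delta>) (pren N (up_ren r)) (PM U)" "ptyped (T # \<Delta>) (pren N' (up_ren r)) (PM U)"
    by (rule ptyped_pren[OF Bind_Plus(2)] ptyped_pren[OF Bind_Plus(3)];
        auto simp: Bind_Plus.prems nth_Cons up_ren_def split: nat.splits)+
  then show ?case
    using peqv.Bind_Plus[OF ptyped_pren[OF Bind_Plus(1) Bind_Plus.prems]] by simp
next
  case (App \<Gamma> M M' T U N N')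
  show ?case unfolding pren.simps by (rule peqv.App; rule App.IH; rule App.prems)
next
  case (Pair \<Gamma> M M' T N N' U)
  show ?case unfolding pren.simps by (rule peqv.Pair; rule Pair.IH; rule Pair.prems)
next
  case (Fst \<Gamma> M M' T U)
  show ?case unfolding pren.simps by (rule peqv.Fst; rule Fst.IH; rule Fst.prems)
next
  case (Snd \<Gamma> M M' T U)
  show ?case unfolding pren.simps by (rule peqv.Snd; rule Snd.IH; rule Snd.prems)
next
  case (Ret \<Gamma> M M' T)
  show ?case unfolding pren.simps by (rule peqv.Ret; rule Ret.IH; rule Ret.prems)
next
  case (Bind \<Gamma> M M' T N N' U)
  show ?case unfolding pren.simps by (rule peqv.Bind; rule Bind.IH; rule Bind.prems)
next
  case (Plus \<Gamma> M M' T N N')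
  show ?case unfolding pren.simps by (rule peqv.Plus; rule Plus.IH; rule Plus.prems)
next
  case (refl \<Gamma> M T)
  show ?case by (rule peqv.refl, rule ptyped_pren[OF refl])
qed (unfold pren.simps pren_up_plift up_ren_simps, (rule peqv.intros(13-25); erule ptyped_pren; simp)+)

lemma peqv_plift: "peqv \<Gamma> M N T \<Longrightarrow> peqv (U # \<Gamma>) (plift M) (plift N) T"
  by (erule peqv_pren) auto

text \<open>
As for \<open>eqv_inst\<close>, by way of \<open>\<beta>\<close>-redexes.
\<close>

lemma peqv_pinst:
  assumes "peqv [T] M M' U" "peqv \<Gamma> N N' T"
  shows "peqv \<Gamma> (pinst M N) (pinst M' N') U"
proof -
  have M: "peqv (T # \<Gamma>) M M' U" using peqv_weaken[OF assms(1), of \<Gamma>] by simp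
  have "peqv \<Gamma> (PApp (PLam M) N) (PApp (PLam M') N') U"
    by (rule peqv.App[OF peqv.Lam[OF M] assms(2)])
  moreover have "peqv \<Gamma> (PApp (PLam M) N) (pinst M N) U" "peqv \<Gamma> (PApp (PLam M') N') (pinst M' N') U"
    using peqv_typed[OF M] peqv_typed[OF assms(2)] by (blast intro: peqv.beta)+
  ultimately show ?thesis by (meson peqv.sym peqv.trans)
qed

section \<open>A type-preserving rewrite relation on raw P-terms\<close>

text \<open>
Each equation of P is oriented so that every type of the left-hand side is a type of the
right-hand side; this needs care because raw terms can have several types. Thus surjective pairing
is restricted to variables: in \<open>\<langle>M\<^sup>1, M\<^sup>2\<rangle>\<close> the two copies of \<open>M\<close> may be typed differently. Likewise
\<open>Zero_split\<close> inverts the unit law for \<open>0\<close> alone: expanding \<open>M\<close> to \<open>0 + M\<close> preserves types only if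
\<open>M\<close> is known to have monadic types only, as \<open>0\<close> does.
\<close>

inductive red :: "ptm \<Rightarrow> ptm \<Rightarrow> bool" (infix "\<leadsto>" 50) where
  refl [intro, simp]: "M \<leadsto> M"
| trans: "M \<leadsto> N \<Longrightarrow> N \<leadsto> P \<Longrightarrow> M \<leadsto> P"
| Lam: "M \<leadsto> M' \<Longrightarrow> PLam M \<leadsto> PLam M'"
| App: "M \<leadsto> M' \<Longrightarrow> N \<leadsto> N' \<Longrightarrow> PApp M N \<leadsto> PApp M' N'"
| Pair: "M \<leadsto> M' \<Longrightarrow> N \<leadsto> N' \<Longrightarrow> PPair M N \<leadsto> PPair M' N'"
| Fst: "M \<leadsto> M' \<Longrightarrow> PFst M \<leadsto> PFst M'"
| Snd: "M \<leadsto> M' \<Longrightarrow> PSnd M \<leadsto> PSnd M'"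
| Bind: "M \<leadsto> M' \<Longrightarrow> N \<leadsto> N' \<Longrightarrow> PBind M N \<leadsto> PBind M' N'"
| Plus: "M \<leadsto> M' \<Longrightarrow> N \<leadsto> N' \<Longrightarrow> PPlus M N \<leadsto> PPlus M' N'"
| beta: "PApp (PLam M) N \<leadsto> pinst M N"
| eta: "PLam (PApp (plift M) (PVar 0)) \<leadsto> M"
| Fst_Pair: "PFst (PPair M N) \<leadsto> M"
| Snd_Pair: "PSnd (PPair M N) \<leadsto> N"
| surj_Pair: "PPair (PFst (PVar n)) (PSnd (PVar n)) \<leadsto> PVar n"
| Ret_Bind: "PBind (PRet M) N \<leadsto> PApp N M"
| Bind_Ret: "PBind M (PLam (PRet (PVar 0))) \<leadsto> M"
| Bind_Bind: "PBind (PBind M N) P \<leadsto> PBind M (PLam (PBind (PApp (plift N) (PVar 0)) (plift P)))"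
| Zero_Plus: "PPlus PZero M \<leadsto> M"
| Zero_split: "PZero \<leadsto> PPlus PZero PZero"
| Plus_assoc: "PPlus (PPlus M N) P \<leadsto> PPlus M (PPlus N P)"
| Plus_commute: "PPlus M N \<leadsto> PPlus N M"
| Zero_Bind: "PBind PZero N \<leadsto> PZero"
| Plus_Bind: "PBind (PPlus M M') N \<leadsto> PPlus (PBind M N) (PBind M' N)"
| Bind_Zero: "PBind M (PLam PZero) \<leadsto> PZero"
| Bind_Plus: "PBind M (PLam (PPlus N N')) \<leadsto> PPlus (PBind M (PLam N)) (PBind M (PLam N'))"

lemma red_pren: "M \<leadsto> N \<Longrightarrow> pren M r \<leadsto> pren N r"
proof (induction arbitrary: r rule: red.induct)
  case (trans M N P)
  then show ?case by (blast intro: red.trans)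
next
  case (beta M N)
  show ?case by (simp add: pren_pinst red.beta)
qed (unfold pren.simps pren_up_plift up_ren_simps, (rule red.intros(1,3-25); simp)+)

text \<open>
Types and equality at the same time: equality implies that both sides have the type in question, so
this is also subject reduction, which the transitivity case relies on.
\<close>

lemma red_peqv: "M \<leadsto> N \<Longrightarrow> ptyped \<Gamma> M T \<Longrightarrow> peqv \<Gamma> M N T"
proof (induction arbitrary: \<Gamma> T rule: red.induct)
  case (trans M N P)
  then show ?case by (blast intro: peqv.trans dest: peqv_typed)
next
  case (eta M)
  then show ?case by (auto simp: ptyped_plift_iff intro!: peqv.eta)
next
  case (surj_Pair n)
  then obtain A B where "T = PProd A B" "\<Gamma> ! n = PProd A B" "n < length \<Gamma>"
    by (auto dest!: HOL.sym[of _ "\<Gamma> ! n"])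
  then show ?case by (auto intro!: peqv.surj_Pair ptyped_Var')
next
  case Zero_split
  then show ?case by (auto intro: peqv.sym peqv.Zero_Plus ptyped.Zero)
next
  case (Bind_Ret M)
  then show ?case by (auto intro!: peqv.Bind_Ret)
qed (blast intro: peqv.intros)+

declare red.trans [trans]

lemma peqv_red: "peqv \<Gamma> M N T \<Longrightarrow> N \<leadsto> K \<Longrightarrow> peqv \<Gamma> M K T"
  by (meson peqv.trans peqv_typed red_peqv)

text \<open>
The pattern of the inductive equality proofs below: an equality known by induction is extended by two
untyped computations that meet.
\<close>

lemma peqv_red_join:
  "peqv \<Gamma> M N T \<Longrightarrow> N \<leadsto> K \<Longrightarrow> M' \<leadsto> K \<Longrightarrow> ptyped \<Gamma> M' T \<Longrightarrow> peqv \<Gamma> M M' T"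
  by (meson peqv.sym peqv.trans peqv_typed red_peqv)

lemmas red_cong = red.Lam red.App red.Pair red.Fst red.Snd red.Bind red.Plus

lemma psub_eqI: "(\<And>n. s n = t n) \<Longrightarrow> psub M s = psub M t"
  by (rule arg_cong[of s t]) (rule ext)

lemma pinst_up_plift [simp]: "pinst (pren M (up_ren Suc)) (PVar 0) = M"
proof -
  have "psub M (\<lambda>n. case_nat (PVar 0) PVar (up_ren Suc n)) = psub M PVar"
    by (rule psub_eqI) (simp add: up_ren_def split: nat.split)
  then show ?thesis by (simp add: pinst_def psub_pren)
qed

lemma pinst_simps [simp]:
  "pinst (PVar 0) N = N" "pinst (PVar (Suc n)) N = PVar n" "pinst PZero N = PZero"
  "pinst (PPlus A B) N = PPlus (pinst A N) (pinst B N)"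
  "pinst (PBind A B) N = PBind (pinst A N) (pinst B N)"
  "pinst (PApp A B) N = PApp (pinst A N) (pinst B N)"
  "pinst (PPair A B) N = PPair (pinst A N) (pinst B N)"
  "pinst (PFst A) N = PFst (pinst A N)" "pinst (PSnd A) N = PSnd (pinst A N)"
  "pinst (PRet A) N = PRet (pinst A N)"
  by (simp_all add: pinst_def)

lemma red_app: "M \<leadsto> PLam B \<Longrightarrow> N \<leadsto> N' \<Longrightarrow> pinst B N' \<leadsto> K \<Longrightarrow> PApp M N \<leadsto> K"
  by (meson red.App red.beta red.trans)

section \<open>Finite sums in P\<close>

text \<open>
The recursion splits off the term with index 0, because passing under a binder adds the bound
variable as variable 0.
\<close>

primrec psum :: "nat \<Rightarrow> (nat \<Rightarrow> ptm) \<Rightarrow> ptm" where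
  "psum 0 f = PZero"
| "psum (Suc n) f = PPlus (f 0) (psum n (\<lambda>x. f (Suc x)))"

lemma psum_psub [simp]: "psub (psum n f) s = psum n (\<lambda>x. psub (f x) s)"
  by (induction n arbitrary: f) simp_all

lemma psum_pren [simp]: "pren (psum n f) r = psum n (\<lambda>x. pren (f x) r)"
  by (induction n arbitrary: f) simp_all

lemma psum_pinst [simp]: "pinst (psum n f) N = psum n (\<lambda>x. pinst (f x) N)"
  by (simp add: pinst_def)

lemma psum_typed: "(\<And>x. x < n \<Longrightarrow> ptyped \<Gamma> (f x) (PM T)) \<Longrightarrow> ptyped \<Gamma> (psum n f) (PM T)"
  by (induction n arbitrary: f) (simp_all add: ptyped.Zero ptyped.Plus)

lemma psum_red: "(\<And>x. x < n \<Longrightarrow> f x \<leadsto> g x) \<Longrightarrow> psum n f \<leadsto> psum n g"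
  by (induction n arbitrary: f g) (simp_all add: red.Plus)

lemma red_Zero_Plus: "M \<leadsto> PZero \<Longrightarrow> N \<leadsto> N' \<Longrightarrow> PPlus M N \<leadsto> N'"
  by (meson red.Plus red.Zero_Plus red.trans)

lemma red_Plus_Zero: "N \<leadsto> PZero \<Longrightarrow> M \<leadsto> M' \<Longrightarrow> PPlus M N \<leadsto> M'"
  by (meson red_Zero_Plus red.Plus_commute red.trans)

lemma red_Bind_Zero: "N \<leadsto> PLam PZero \<Longrightarrow> PBind M N \<leadsto> PZero"
  by (meson red.Bind red.Bind_Zero red.trans red.refl)

lemma red_Zero_Bind: "M \<leadsto> PZero \<Longrightarrow> PBind M N \<leadsto> PZero"
  by (meson red.Bind red.Zero_Bind red.trans red.refl)

lemma psum_zero: "(\<And>x. x < n \<Longrightarrow> f x \<leadsto> PZero) \<Longrightarrow> psum n f \<leadsto> PZero"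
  by (induction n arbitrary: f) (simp_all add: red_Zero_Plus)

lemma psum_single:
  assumes "k < n" "f k \<leadsto> K" "\<And>x. x < n \<Longrightarrow> x \<noteq> k \<Longrightarrow> f x \<leadsto> PZero"
  shows "psum n f \<leadsto> K"
  using assms
proof (induction n arbitrary: f k)
  case (Suc n)
  show ?case
  proof (cases k)
    case 0
    then show ?thesis using Suc.prems by (auto intro!: red_Plus_Zero psum_zero)
  next
    case (Suc j)
    have "psum n (\<lambda>x. f (Suc x)) \<leadsto> K"
      by (rule Suc.IH[of j]) (use Suc.prems Suc in auto)
    then show ?thesis using Suc.prems Suc by (auto intro!: red_Zero_Plus)
  qed
qed simp

lemma Plus_swap: "PPlus (PPlus A B) (PPlus C D) \<leadsto> PPlus (PPlus A C) (PPlus B D)"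
proof -
  have rassoc: "PPlus A (PPlus B C) \<leadsto> PPlus (PPlus A B) C" for A B C
    by (meson red.Plus_assoc red.Plus_commute red.trans)
  have "PPlus (PPlus A B) (PPlus C D) \<leadsto> PPlus A (PPlus B (PPlus C D))" by (rule red.Plus_assoc)
  also have "\<dots> \<leadsto> PPlus A (PPlus (PPlus B C) D)" by (intro red_cong rassoc red.refl)
  also have "\<dots> \<leadsto> PPlus A (PPlus (PPlus C B) D)"
    by (intro red_cong red.Plus_commute red.refl)
  also have "\<dots> \<leadsto> PPlus A (PPlus C (PPlus B D))"
    by (intro red_cong red.Plus_assoc red.refl)
  also have "\<dots> \<leadsto> PPlus (PPlus A C) (PPlus B D)" by (rule rassoc)
  finally show ?thesis .
qed

lemma psum_plus: "psum n (\<lambda>x. PPlus (f x) (g x)) \<leadsto> PPlus (psum n f) (psum n g)"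
proof (induction n arbitrary: f g)
  case (Suc n)
  have "psum (Suc n) (\<lambda>x. PPlus (f x) (g x)) \<leadsto>
      PPlus (PPlus (f 0) (g 0)) (PPlus (psum n (\<lambda>x. f (Suc x))) (psum n (\<lambda>x. g (Suc x))))"
    by (simp add: red.Plus Suc.IH)
  also have "\<dots> \<leadsto> PPlus (PPlus (f 0) (psum n (\<lambda>x. f (Suc x)))) (PPlus (g 0) (psum n (\<lambda>x. g (Suc x))))"
    by (rule Plus_swap)
  finally show ?case by simp
qed (simp add: red.Zero_split)

lemma psum_bind: "PBind M (PLam (psum n f)) \<leadsto> psum n (\<lambda>x. PBind M (PLam (f x)))"
proof (induction n arbitrary: f)
  case (Suc n)
  show ?case by simp (rule red.trans[OF red.Bind_Plus red.Plus[OF red.refl Suc.IH]])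
qed (simp add: red.Bind_Zero)

section \<open>Shape, typing and renaming of the Dialectica transformation\<close>

text \<open>
The two ways in which the transformation builds a backward map, for an abstraction and for an
application. Naming them lets renaming, substitution, typing and equality be treated once per
shape: \<open>uncurry_abs G\<close> is \<open>\<lambda>\<pi>. (\<lambda>x. G) \<pi>\<^sup>1 \<pi>\<^sup>2\<close>, with \<open>G\<close> under the binder \<open>x\<close>.
\<close>

definition uncurry_abs :: "ptm \<Rightarrow> ptm" where
  "uncurry_abs G = PLam (PApp (PApp (plift (PLam G)) (PFst (PVar 0))) (PSnd (PVar 0)))"

definition pull_of_app :: "ptm \<Rightarrow> ptm \<Rightarrow> ptm \<Rightarrow> ptm \<Rightarrow> ptm" where
  "pull_of_app P Py Q Qy = PLam (PPlus
       (PApp (plift Py) (PPair (plift Q) (PVar 0)))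
       (PBind (PApp (PSnd (plift P)) (PPair (plift Q) (PVar 0))) (plift Qy)))"

lemma bullet_pull_folded:
  "bullet (Lam M) = PPair (PLam (bullet M)) (uncurry_abs (pull 0 M))"
  "pull y (Lam M) = uncurry_abs (pull (Suc y) M)"
  "pull y (App P Q) = pull_of_app (bullet P) (pull y P) (bullet Q) (pull y Q)"
  by (simp_all add: uncurry_abs_def pull_of_app_def)

declare bullet.simps(2) [simp del] pull.simps(2,3) [simp del]
declare bullet_pull_folded [simp]

lemma uncurry_abs_psub [simp]: "psub (uncurry_abs G) s = uncurry_abs (psub G (up_psub s))"
  using psub_up_plift[of "PLam G" s] by (simp add: uncurry_abs_def del: psub_up_plift)

lemma uncurry_abs_pren [simp]: "pren (uncurry_abs G) r = uncurry_abs (pren G (up_ren r))"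
  using pren_up_plift[of "PLam G" r] by (simp add: uncurry_abs_def del: pren_up_plift)

lemma pull_of_app_psub [simp]:
  "psub (pull_of_app P Py Q Qy) s = pull_of_app (psub P s) (psub Py s) (psub Q s) (psub Qy s)"
  by (simp add: pull_of_app_def)

lemma pull_of_app_pren [simp]:
  "pren (pull_of_app P Py Q Qy) r = pull_of_app (pren P r) (pren Py r) (pren Q r) (pren Qy r)"
  by (simp add: pull_of_app_def)

lemma uncurry_abs_typed:
  "ptyped (T # \<Gamma>) G (PArr U V) \<Longrightarrow> ptyped \<Gamma> (uncurry_abs G) (PArr (PProd T U) V)"
  unfolding uncurry_abs_def by ((assumption | rule ptyped_rules)+)

lemma pull_of_app_typed:
  "ptyped \<Gamma> P (PProd A (PArr (PProd T U) (PM V))) \<Longrightarrow> ptyped \<Gamma> Py (PArr (PProd T U) (PM X)) \<Longrightarrow>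
   ptyped \<Gamma> Q T \<Longrightarrow> ptyped \<Gamma> Qy (PArr V (PM X)) \<Longrightarrow> ptyped \<Gamma> (pull_of_app P Py Q Qy) (PArr U (PM X))"
  unfolding pull_of_app_def by ((assumption | rule ptyped_rules)+)

lemma peqv_PVar0: "peqv (T # \<Gamma>) (PVar 0) (PVar 0) T"
  by (rule peqv.refl[OF ptyped_PVar0])

lemmas peqv_cong = peqv_PVar0 peqv_plift peqv.Lam peqv.App peqv.Pair peqv.Fst peqv.Snd peqv.Ret
  peqv.Bind peqv.Plus

lemma uncurry_abs_peqv:
  "peqv (T # \<Gamma>) G G' (PArr U V) \<Longrightarrow> peqv \<Gamma> (uncurry_abs G) (uncurry_abs G') (PArr (PProd T U) V)"
  unfolding uncurry_abs_def by ((assumption | rule peqv_cong)+)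

lemma pull_of_app_peqv:
  "peqv \<Gamma> P P' (PProd A (PArr (PProd T U) (PM V))) \<Longrightarrow> peqv \<Gamma> Py Py' (PArr (PProd T U) (PM X)) \<Longrightarrow>
   peqv \<Gamma> Q Q' T \<Longrightarrow> peqv \<Gamma> Qy Qy' (PArr V (PM X)) \<Longrightarrow>
   peqv \<Gamma> (pull_of_app P Py Q Qy) (pull_of_app P' Py' Q' Qy') (PArr U (PM X))"
  unfolding pull_of_app_def by ((assumption | rule peqv_cong)+)

lemma uncurry_abs_red: "G \<leadsto> G' \<Longrightarrow> uncurry_abs G \<leadsto> uncurry_abs G'"
  unfolding uncurry_abs_def by (intro red.Lam red.App red_pren red.refl)

lemma uncurry_abs_app: "PApp (uncurry_abs G) N \<leadsto> PApp (pinst G (PFst N)) (PSnd N)"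
proof -
  have "PApp (uncurry_abs G) N \<leadsto> PApp (PApp (PLam G) (PFst N)) (PSnd N)"
    unfolding uncurry_abs_def by (rule red_app[OF red.refl red.refl]) (simp del: pren.simps)
  then show ?thesis by (rule red.trans) (rule red.App[OF red.beta red.refl])
qed

lemma uncurry_abs_eta: "uncurry_abs G \<leadsto> PLam (PApp (pinst (pren G (up_ren Suc)) (PFst (PVar 0))) (PSnd (PVar 0)))"
  unfolding uncurry_abs_def pren.simps by (rule red.Lam[OF red.App[OF red.beta red.refl]])

lemma bullet_pull_typed:
  assumes "typed \<Gamma> M E"
  shows "ptyped (map (W_ty gW gC) \<Gamma>) (bullet M) (W_ty gW gC E) \<and>
    (\<forall>y < length \<Gamma>. ptyped (map (W_ty gW gC) \<Gamma>) (pull y M)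
       (PArr (C_ty gW gC E) (PM (C_ty gW gC (\<Gamma> ! y)))))"
  using assms
proof (induction rule: typed.induct)
  case (Var n \<Gamma>)
  then show ?case by (auto intro!: ptyped_rules ptyped_Var')
next
  case (Lam E \<Gamma> M F)
  have "ptyped (W_ty gW gC E # map (W_ty gW gC) \<Gamma>) (pull (Suc y) M)
      (PArr (C_ty gW gC F) (PM (C_ty gW gC (\<Gamma> ! y))))" if "y < length \<Gamma>" for y
    using Lam.IH that by (auto dest!: conjunct2 spec[of _ "Suc y"])
  then show ?case using Lam.IH by (auto intro!: ptyped.Pair ptyped.Lam uncurry_abs_typed)
next
  case (App \<Gamma> M E F N)
  then show ?case by (auto intro: ptyped.App ptyped.Fst pull_of_app_typed)
qed

lemmas bullet_typed = bullet_pull_typed[THEN conjunct1]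
lemmas pull_typed = bullet_pull_typed[THEN conjunct2, rule_format]

lemma up_ren_inj: "inj r \<Longrightarrow> inj (up_ren r)"
  by (rule injI) (auto simp: up_ren_def inj_eq split: nat.splits)

text \<open>
Injectivity is essential: \<open>pull\<close> compares variables, and identifying two of them would add up their
derivatives.
\<close>

lemma bullet_pull_ren:
  "inj r \<Longrightarrow> bullet (ren M r) = pren (bullet M) r \<and> (\<forall>y. pull (r y) (ren M r) = pren (pull y M) r)"
proof (induction M arbitrary: r)
  case (Var x)
  then show ?case by (auto simp: inj_eq)
next
  case (Lam M)
  have IH: "bullet (ren M (up_ren r)) = pren (bullet M) (up_ren r)"
    "pull (up_ren r y) (ren M (up_ren r)) = pren (pull y M) (up_ren r)" for y
    using Lam.IH[OF up_ren_inj[OF Lam.prems]] by auto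
  show ?case using IH(1) IH(2)[of 0] IH(2)[of "Suc _"] by simp
next
  case (App M N)
  then show ?case by simp
qed

lemma bullet_lift [simp]: "bullet (ren M Suc) = plift (bullet M)"
  using bullet_pull_ren[of Suc M] by simp

lemma pull_lift [simp]: "pull (Suc y) (ren M Suc) = plift (pull y M)"
  using bullet_pull_ren[of Suc M] by simp

text \<open>
The derivative in a variable that does not occur is zero; not occurring is expressed as lying
outside the range of a renaming.
\<close>

lemma pull_fresh: "(\<And>n. r n \<noteq> y) \<Longrightarrow> pull y (ren M r) \<leadsto> PLam PZero"
proof (induction M arbitrary: r y)
  case (Var x)
  then show ?case by simp
next
  case (Lam M)
  have "pull (Suc y) (ren M (up_ren r)) \<leadsto> PLam PZero"
    by (rule Lam.IH) (use Lam.prems in \<open>simp add: up_ren_def split: nat.split\<close>)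
  then have "uncurry_abs (pull (Suc y) (ren M (up_ren r))) \<leadsto> uncurry_abs (PLam PZero)" by (rule uncurry_abs_red)
  also have "\<dots> \<leadsto> PLam PZero"
    by (rule red.trans[OF uncurry_abs_eta]) (auto simp: pinst_def intro!: red.Lam red_app[OF red.refl red.refl])
  finally show ?case by simp
next
  case (App P Q)
  have "plift (pull y (ren P r)) \<leadsto> PLam PZero" "plift (pull y (ren Q r)) \<leadsto> PLam PZero"
    using App.IH[of r y, THEN red_pren[of _ _ Suc]] App.prems by simp_all
  then show ?case unfolding ren.simps bullet_pull_folded pull_of_app_def
    by (intro red.Lam red_Zero_Plus red_Bind_Zero) (rule red_app[OF _ red.refl], assumption, simp)
qed

lemma pull_0_lift: "pull 0 (ren M Suc) \<leadsto> PLam PZero"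
  by (rule pull_fresh) simp

section \<open>The chain rule\<close>

lemma bullet_up: "(\<lambda>x. bullet (up_sub s x)) = up_psub (\<lambda>x. bullet (s x))"
  by (rule ext) (simp add: up_sub_def up_psub_def split: nat.split)

text \<open>
The body, with \<open>\<pi>\<close> as variable 0, of the right-hand side of the chain rule. The bound \<open>n\<close> is the
length of the context of \<open>M\<close>; the terms of the sum have the common type \<open>\<M>[C]\<close> of the opponents of
\<open>y\<close>, although the intermediate types vary with \<open>x\<close>.
\<close>

definition chain_sum :: "nat \<Rightarrow> nat \<Rightarrow> tm \<Rightarrow> (nat \<Rightarrow> tm) \<Rightarrow> ptm" where
  "chain_sum n y M s = psum n (\<lambda>x. PBind
     (PApp (plift (psub (pull x M) (\<lambda>i. bullet (s i)))) (PVar 0)) (plift (pull y (s x))))"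

lemma red_app_lift: "M \<leadsto> PLam B \<Longrightarrow> PApp (plift M) (PVar 0) \<leadsto> B"
  using red_app[OF red_pren[of M "PLam B" Suc, unfolded pren.simps] red.refl[of "PVar 0"]] by simp

lemma eta_back: "N \<leadsto> PApp (plift M) (PVar 0) \<Longrightarrow> PLam N \<leadsto> M"
  by (rule red.trans[OF red.Lam red.eta])

text \<open>
The derivative of a variable is a unit or zero, so the sum collapses to one term.
\<close>

lemma chain_sum_Var: "i < n \<Longrightarrow> PLam (chain_sum n y (Var i) s) \<leadsto> pull y (s i)"
  unfolding chain_sum_def
proof (rule eta_back, rule psum_single[of i])
  show "PBind (PApp (plift (psub (pull i (Var i)) (\<lambda>i. bullet (s i)))) (PVar 0)) (plift (pull y (s i)))
    \<leadsto> PApp (plift (pull y (s i))) (PVar 0)"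
  proof -
    have "PApp (plift (psub (pull i (Var i)) (\<lambda>i. bullet (s i)))) (PVar 0) \<leadsto> PRet (PVar 0)"
      by (rule red_app_lift) simp
    then show ?thesis by (rule red.trans[OF red.Bind[OF _ red.refl] red.Ret_Bind])
  qed
qed (auto intro!: red_Zero_Bind red_app[OF red.refl red.refl])

text \<open>
Under the binder the sum has one more term, for the bound variable. That variable is substituted
by itself, whose derivative in an outer variable vanishes.
\<close>

lemma chain_sum_Lam:
  "\<exists>K. uncurry_abs (PLam (chain_sum (Suc n) (Suc y) M (up_sub s))) \<leadsto> K \<and> PLam (chain_sum n y (Lam M) s) \<leadsto> K"
proof -
  define \<sigma> where "\<sigma> = (\<lambda>x. bullet (s x))"
  define G where "G = (\<lambda>x. psub (pull (Suc x) M) (up_psub \<sigma>))"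
  define S where "S = (\<lambda>x. pull y (s x))"
  let ?S = "psum n (\<lambda>x. PBind (PApp (plift (G x)) (PVar 0)) (plift (plift (S x))))"
  let ?K = "PLam (psum n (\<lambda>x. PBind
    (PApp (pinst (pren (G x) (up_ren Suc)) (PFst (PVar 0))) (PSnd (PVar 0))) (plift (S x))))"
  have "chain_sum (Suc n) (Suc y) M (up_sub s) \<leadsto> ?S"
    unfolding chain_sum_def psum.simps bullet_up \<sigma>_def G_def S_def
    by (intro red_Zero_Plus red_Bind_Zero) simp_all
  then have "uncurry_abs (PLam (chain_sum (Suc n) (Suc y) M (up_sub s))) \<leadsto> uncurry_abs (PLam ?S)"
    by (intro uncurry_abs_red red.Lam)
  also have "\<dots> \<leadsto> ?K"
  proof -
    have "PApp (pinst (pren (PLam ?S) (up_ren Suc)) (PFst (PVar 0))) (PSnd (PVar 0)) \<leadsto>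
      psum n (\<lambda>x. PBind
        (PApp (pinst (pren (G x) (up_ren Suc)) (PFst (PVar 0))) (PSnd (PVar 0))) (plift (S x)))"
      by (simp add: pinst_def[of "PLam _"], rule red.trans[OF red.beta])
        (simp add: pinst_def[symmetric])
    then show ?thesis by (rule red.trans[OF uncurry_abs_eta red.Lam])
  qed
  finally have "uncurry_abs (PLam (chain_sum (Suc n) (Suc y) M (up_sub s))) \<leadsto> ?K" .
  moreover have "PLam (chain_sum n y (Lam M) s) \<leadsto> ?K"
    unfolding chain_sum_def \<sigma>_def[symmetric]
    by (intro red.Lam psum_red red.Bind) (simp_all add: uncurry_abs_app G_def S_def)
  ultimately show ?thesis by blast
qed

text \<open>
Linearity: the two summands in the derivative of an application are sums over \<open>x\<close> by induction.
Distributivity of bind over sums on both sides and associativity regroup them into one sum.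
\<close>

lemma chain_sum_App:
  fixes s
  defines "\<sigma> \<equiv> (\<lambda>x. bullet (s x))"
  shows "\<exists>K. pull_of_app (psub (bullet P) \<sigma>) (PLam (chain_sum n y P s)) (psub (bullet Q) \<sigma>) (PLam (chain_sum n y Q s)) \<leadsto> K
    \<and> PLam (chain_sum n y (App P Q) s) \<leadsto> K"
proof -
  \<comment> \<open>\<open>?A\<close> is \<open>\<langle>Q\<^sup>\<bullet>, \<pi>\<rangle>\<close> and \<open>?B\<close> is \<open>(P\<^sup>\<bullet>)\<^sup>2 \<langle>Q\<^sup>\<bullet>, \<pi>\<rangle>\<close>, both after substitution.\<close>
  let ?A = "PPair (plift (psub (bullet Q) \<sigma>)) (PVar 0)"
  let ?B = "PApp (PSnd (plift (psub (bullet P) \<sigma>))) ?A"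
  define P' where "P' = (\<lambda>x. psub (pull x P) \<sigma>)"
  define Q' where "Q' = (\<lambda>x. psub (pull x Q) \<sigma>)"
  define S where "S = (\<lambda>x. pull y (s x))"
  let ?K = "PPlus (psum n (\<lambda>x. PBind (PApp (plift (P' x)) ?A) (plift (S x))))
       (psum n (\<lambda>x. PBind ?B (PLam (PBind (PApp (plift (plift (Q' x))) (PVar 0)) (plift (plift (S x)))))))"
  have P: "chain_sum n y P s = psum n (\<lambda>x. PBind (PApp (plift (P' x)) (PVar 0)) (plift (S x)))"
    and Q: "chain_sum n y Q s = psum n (\<lambda>x. PBind (PApp (plift (Q' x)) (PVar 0)) (plift (S x)))"
    by (simp_all add: chain_sum_def P'_def Q'_def S_def \<sigma>_def)
  have "pull_of_app (psub (bullet P) \<sigma>) (PLam (chain_sum n y P s)) (psub (bullet Q) \<sigma>) (PLam (chain_sum n y Q s)) \<leadsto> PLam ?K"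
    unfolding P Q pull_of_app_def
    by (rule red.Lam, rule red.Plus) (simp, rule red.trans[OF red.beta], simp, simp, rule psum_bind)
  moreover have "PLam (chain_sum n y (App P Q) s) \<leadsto> PLam ?K"
  proof (rule red.Lam)
    have "PBind (PApp (plift (psub (pull x (App P Q)) \<sigma>)) (PVar 0)) (plift (S x)) \<leadsto>
      PPlus (PBind (PApp (plift (P' x)) ?A) (plift (S x)))
        (PBind ?B (PLam (PBind (PApp (plift (plift (Q' x))) (PVar 0)) (plift (plift (S x))))))" for x
    proof -
      have "PApp (plift (psub (pull x (App P Q)) \<sigma>)) (PVar 0) \<leadsto>
        PPlus (PApp (plift (P' x)) ?A) (PBind ?B (plift (Q' x)))"
        by (rule red_app_lift) (simp add: P'_def Q'_def pull_of_app_def)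
      then have "PBind (PApp (plift (psub (pull x (App P Q)) \<sigma>)) (PVar 0)) (plift (S x)) \<leadsto>
        PBind (PPlus (PApp (plift (P' x)) ?A) (PBind ?B (plift (Q' x)))) (plift (S x))"
        by (rule red.Bind) simp
      also have "\<dots> \<leadsto> PPlus (PBind (PApp (plift (P' x)) ?A) (plift (S x)))
          (PBind (PBind ?B (plift (Q' x))) (plift (S x)))" by (rule red.Plus_Bind)
      finally show ?thesis by (rule red.trans) (rule red.Plus[OF red.refl red.Bind_Bind])
    qed
    then have "chain_sum n y (App P Q) s \<leadsto> psum n (\<lambda>x. PPlus (PBind (PApp (plift (P' x)) ?A) (plift (S x)))
        (PBind ?B (PLam (PBind (PApp (plift (plift (Q' x))) (PVar 0)) (plift (plift (S x)))))))"
      unfolding chain_sum_def S_def \<sigma>_def by (intro psum_red)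
    then show "chain_sum n y (App P Q) s \<leadsto> ?K" by (rule red.trans) (rule psum_plus)
  qed
  ultimately show ?thesis by blast
qed

lemma chain_sum_typed:
  assumes "\<And>x. x < n \<Longrightarrow> ptyped \<Gamma> (psub (pull x M) (\<lambda>i. bullet (s i))) (PArr T (PM (V x)))"
    "\<And>x. x < n \<Longrightarrow> ptyped \<Gamma> (pull y (s x)) (PArr (V x) (PM U))"
  shows "ptyped \<Gamma> (PLam (chain_sum n y M s)) (PArr T (PM U))"
  unfolding chain_sum_def
  by (rule ptyped.Lam, rule psum_typed, rule ptyped.Bind[OF ptyped.App[OF ptyped_plift[OF assms(1)]
      ptyped_PVar0] ptyped_plift[OF assms(2)]])

text \<open>
Both parts are proved together: the backward component of \<open>bullet (Lam M)\<close> is a derivative in the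
bound variable, so the statement for \<open>bullet\<close> under a binder needs the chain rule, in which only the
term for the bound variable survives.
\<close>

lemma chain_rule:
  fixes gW gC :: "'g \<Rightarrow> 'p"
  defines "W \<equiv> W_ty gW gC" and "C \<equiv> C_ty gW gC"
  assumes "typed \<Gamma> M E" "\<And>x. x < length \<Gamma> \<Longrightarrow> typed \<Delta> (s x) (\<Gamma> ! x)"
  shows "peqv (map W \<Delta>) (bullet (sub M s)) (psub (bullet M) (\<lambda>x. bullet (s x))) (W E) \<and>
    (\<forall>y < length \<Delta>. peqv (map W \<Delta>) (pull y (sub M s)) (PLam (chain_sum (length \<Gamma>) y M s))
       (PArr (C E) (PM (C (\<Delta> ! y)))))"
  using assms(3-)
proof (induction arbitrary: \<Delta> s rule: typed.induct)
  have bt: "ptyped (map W \<Gamma>) (bullet M) (W E)" if "typed \<Gamma> M E" for \<Gamma> M E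
    unfolding W_def by (rule bullet_typed[OF that])
  have pt: "ptyped (map W \<Gamma>) (pull y M) (PArr (C E) (PM (C (\<Gamma> ! y))))"
    if "typed \<Gamma> M E" "y < length \<Gamma>" for \<Gamma> M E y
    unfolding W_def C_def by (rule pull_typed[OF that])
  have ct: "ptyped (map W \<Delta>) (PLam (chain_sum (length \<Gamma>) y M s)) (PArr (C E) (PM (C (\<Delta> ! y))))"
    if M: "typed \<Gamma> M E" and s: "\<And>x. x < length \<Gamma> \<Longrightarrow> typed \<Delta> (s x) (\<Gamma> ! x)" and y: "y < length \<Delta>"
    for \<Gamma> \<Delta> y M s E
  proof (rule chain_sum_typed)
    fix x assume x: "x < length \<Gamma>"
    show "ptyped (map W \<Delta>) (psub (pull x M) (\<lambda>i. bullet (s i))) (PArr (C E) (PM (C (\<Gamma> ! x))))"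
      by (rule ptyped_psub[OF pt[OF M x]]) (simp add: bt s)
    show "ptyped (map W \<Delta>) (pull y (s x)) (PArr (C (\<Gamma> ! x)) (PM (C (\<Delta> ! y))))"
      by (rule pt[OF s[OF x] y])
  qed
  {
    case (Var n \<Gamma>)
    then have n: "n < length \<Gamma>" and s: "typed \<Delta> (s n) (\<Gamma> ! n)" by auto
    have "peqv (map W \<Delta>) (pull y (s n)) (PLam (chain_sum (length \<Gamma>) y (Var n) s))
        (PArr (C (\<Gamma> ! n)) (PM (C (\<Delta> ! y))))" if y: "y < length \<Delta>" for y
      using red_peqv[OF chain_sum_Var[OF n] ct[OF typed.Var[OF n] Var.prems y]] by (blast intro: peqv.sym)
    then show ?case using bt[OF s] by (simp add: peqv.refl)
  next
    case (Lam E \<Gamma> M F)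
    have up: "typed (E # \<Delta>) (up_sub s x) ((E # \<Gamma>) ! x)" if "x < length (E # \<Gamma>)" for x
      using that Lam.prems by (cases x) (auto intro!: typed_ren typed.Var[of 0 "E # _", simplified])
    note IH = Lam.IH[OF up]
    have LamM: "typed \<Gamma> (Lam M) (Arr E F)" and subM: "typed (E # \<Delta>) (sub M (up_sub s)) F"
      using Lam.hyps typed_sub[OF Lam.hyps up] by (auto intro: typed.Lam)
    have C: "C (Arr E F) = PProd (W E) (C F)" by (simp add: C_def W_def)
    have W: "W (Arr E F) = PProd (PArr (W E) (W F)) (PArr (PProd (W E) (C F)) (PM (C E)))"
      by (simp add: C_def W_def)
    have "peqv (map W \<Delta>) (uncurry_abs (pull (Suc y) (sub M (up_sub s)))) (PLam (chain_sum (length \<Gamma>) y (Lam M) s))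
        (PArr (C (Arr E F)) (PM (C (\<Delta> ! y))))" if y: "y < length \<Delta>" for y
    proof -
      let ?c = "PLam (chain_sum (Suc (length \<Gamma>)) (Suc y) M (up_sub s))"
      have 1: "peqv (map W (E # \<Delta>)) (pull (Suc y) (sub M (up_sub s))) ?c (PArr (C F) (PM (C (\<Delta> ! y))))"
        using IH y by (auto dest!: conjunct2 spec[of _ "Suc y"])
      then have 2: "peqv (map W \<Delta>) (uncurry_abs (pull (Suc y) (sub M (up_sub s)))) (uncurry_abs ?c)
          (PArr (C (Arr E F)) (PM (C (\<Delta> ! y))))" unfolding C by (intro uncurry_abs_peqv) simp
      obtain K where "uncurry_abs ?c \<leadsto> K" "PLam (chain_sum (length \<Gamma>) y (Lam M) s) \<leadsto> K"
        using chain_sum_Lam by blast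
      then show ?thesis by (rule peqv_red_join[OF 2 _ _ ct[OF LamM Lam.prems y]])
    qed
    moreover have "peqv (W E # map W \<Delta>) (pull 0 (sub M (up_sub s))) (psub (pull 0 M) (up_psub (\<lambda>x. bullet (s x))))
      (PArr (C F) (PM (C E)))"
    proof -
      have 1: "peqv (W E # map W \<Delta>) (pull 0 (sub M (up_sub s)))
          (PLam (chain_sum (Suc (length \<Gamma>)) 0 M (up_sub s))) (PArr (C F) (PM (C E)))"
        using IH by auto
      have "PLam (chain_sum (Suc (length \<Gamma>)) 0 M (up_sub s)) \<leadsto> psub (pull 0 M) (up_psub (\<lambda>x. bullet (s x)))"
        unfolding chain_sum_def psum.simps bullet_up
      proof (rule eta_back, rule red_Plus_Zero)
        show "psum (length \<Gamma>) (\<lambda>x. PBind (PApp (plift (psub (pull (Suc x) M) (up_psub (\<lambda>x. bullet (s x))))) (PVar 0))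
            (plift (pull 0 (up_sub s (Suc x))))) \<leadsto> PZero"
          using red_pren[OF pull_0_lift, of _ Suc] by (intro psum_zero red_Bind_Zero) simp
        show "PBind (PApp (plift (psub (pull 0 M) (up_psub (\<lambda>x. bullet (s x))))) (PVar 0)) (plift (pull 0 (up_sub s 0)))
            \<leadsto> PApp (plift (psub (pull 0 M) (up_psub (\<lambda>x. bullet (s x))))) (PVar 0)"
          by (simp add: red.Bind_Ret)
      qed
      then show ?thesis by (rule peqv_red[OF 1])
    qed
    moreover have "peqv (W E # map W \<Delta>) (bullet (sub M (up_sub s))) (psub (bullet M) (up_psub (\<lambda>x. bullet (s x)))) (W F)"
      using IH by (simp add: bullet_up)
    ultimately show ?case
      unfolding W sub.simps bullet_pull_folded psub.simps uncurry_abs_psub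
      by (blast intro: peqv.Pair peqv.Lam uncurry_abs_peqv)
  next
    case (App \<Gamma> P E F Q)
    have AppPQ: "typed \<Gamma> (App P Q) F" using App.hyps by (rule typed.App)
    have W: "W (Arr E F) = PProd (PArr (W E) (W F)) (PArr (PProd (W E) (C F)) (PM (C E)))"
      and C: "C (Arr E F) = PProd (W E) (C F)"
      by (simp_all add: C_def W_def)
    note IHP = App.IH(1)[OF App.prems] and IHQ = App.IH(2)[OF App.prems]
    have "peqv (map W \<Delta>) (pull y (sub (App P Q) s)) (PLam (chain_sum (length \<Gamma>) y (App P Q) s))
        (PArr (C F) (PM (C (\<Delta> ! y))))" if y: "y < length \<Delta>" for y
    proof -
      let ?p = "pull_of_app (psub (bullet P) (\<lambda>x. bullet (s x))) (PLam (chain_sum (length \<Gamma>) y P s))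
            (psub (bullet Q) (\<lambda>x. bullet (s x))) (PLam (chain_sum (length \<Gamma>) y Q s))"
      have 1: "peqv (map W \<Delta>) (pull y (sub (App P Q) s)) ?p (PArr (C F) (PM (C (\<Delta> ! y))))"
        using IHP IHQ y unfolding W C by (auto intro: pull_of_app_peqv)
      obtain K where "?p \<leadsto> K" "PLam (chain_sum (length \<Gamma>) y (App P Q) s) \<leadsto> K"
        using chain_sum_App by blast
      then show ?thesis by (rule peqv_red_join[OF 1 _ _ ct[OF AppPQ App.prems y]])
    qed
    moreover have "peqv (map W \<Delta>) (bullet (sub (App P Q) s)) (psub (bullet (App P Q)) (\<lambda>x. bullet (s x))) (W F)"
      using IHP IHQ unfolding W by (auto intro: peqv.App peqv.Fst)
    ultimately show ?case by blast
  }
qed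

section \<open>Soundness of the translation\<close>

text \<open>
For \<open>bullet\<close> the computation stops at \<open>\<langle>(M\<^sup>\<bullet>)\<^sup>1, (M\<^sup>\<bullet>)\<^sup>2\<rangle>\<close>, since surjective pairing of a term that is
not a variable needs the typed equality.
\<close>

lemma bullet_pull_eta:
  shows "bullet (Lam (App (ren M Suc) (Var 0))) \<leadsto> PPair (PFst (bullet M)) (PSnd (bullet M))"
    and "pull y (Lam (App (ren M Suc) (Var 0))) \<leadsto> pull y M"
proof -
  have pair: "PLam (PApp (plift A) (PPair (PFst (PVar 0)) (PSnd (PVar 0)))) \<leadsto> A" for A
    by (rule red.trans[OF red.Lam[OF red.App[OF red.refl red.surj_Pair]] red.eta])
  have 0: "pull 0 (App (ren M Suc) (Var 0)) \<leadsto>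
      PLam (PApp (PSnd (plift (plift (bullet M)))) (PPair (PVar (Suc 0)) (PVar 0)))"
  proof -
    have "plift (pull 0 (ren M Suc)) \<leadsto> PLam PZero"
      using red_pren[OF pull_0_lift, of M Suc] by simp
    then show ?thesis
      unfolding bullet_pull_folded pull_of_app_def
      by (intro red.Lam red_Zero_Plus) (rule red_app[OF _ red.refl], assumption, simp, simp add: red.Bind_Ret)
  qed
  have 1: "pull (Suc y) (App (ren M Suc) (Var 0)) \<leadsto>
      PLam (PApp (plift (plift (pull y M))) (PPair (PVar (Suc 0)) (PVar 0)))"
    unfolding bullet_pull_folded pull_of_app_def
    by (intro red.Lam red_Plus_Zero red_Bind_Zero) simp_all
  have unc: "uncurry_abs (PLam (PApp (plift (plift A)) (PPair (PVar (Suc 0)) (PVar 0)))) \<leadsto> A" for A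
  proof -
    have "PApp (pinst (pren (PLam (PApp (plift (plift A)) (PPair (PVar (Suc 0)) (PVar 0)))) (up_ren Suc)) (PFst (PVar 0)))
        (PSnd (PVar 0)) \<leadsto> PApp (plift A) (PPair (PFst (PVar 0)) (PSnd (PVar 0)))"
      by (simp add: pinst_def[of "PLam _"], rule red.trans[OF red.beta])
        (simp add: pinst_def[symmetric])
    then show ?thesis by (rule red.trans[OF uncurry_abs_eta red.trans[OF red.Lam pair]])
  qed
  show "pull y (Lam (App (ren M Suc) (Var 0))) \<leadsto> pull y M"
    unfolding bullet_pull_folded(2) by (rule red.trans[OF uncurry_abs_red[OF 1] unc])
  show "bullet (Lam (App (ren M Suc) (Var 0))) \<leadsto> PPair (PFst (bullet M)) (PSnd (bullet M))"
    unfolding bullet_pull_folded(1)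
    using red.trans[OF uncurry_abs_red[OF 0] unc[of "PSnd (bullet M)", simplified]]
    by (intro red.Pair) (simp_all add: red.eta[of "PFst _", simplified])
qed

lemma uncurry_abs_app_Pair: "PApp (uncurry_abs G) (PPair A B) \<leadsto> PApp (pinst G A) B"
proof -
  have "PApp (uncurry_abs G) (PPair A B) \<leadsto> PApp (PApp (PLam G) (PFst (PPair A B))) (PSnd (PPair A B))"
    unfolding uncurry_abs_def by (rule red_app[OF red.refl red.refl]) (simp del: pren.simps)
  also have "\<dots> \<leadsto> PApp (PApp (PLam G) A) B"
    by (rule red.App[OF red.App[OF red.refl red.Fst_Pair] red.Snd_Pair])
  also have "\<dots> \<leadsto> PApp (pinst G A) B" by (rule red.App[OF red.beta red.refl])
  finally show ?thesis .
qed

lemma bullet_case_nat: "(\<lambda>x. bullet (case_nat N Var x)) = case_nat (bullet N) PVar"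
  by (rule ext) (simp split: nat.split)

lemma bullet_beta: "bullet (App (Lam M) N) \<leadsto> pinst (bullet M) (bullet N)"
  unfolding bullet.simps(3) bullet_pull_folded(1)
  by (rule red.trans[OF red.App[OF red.Fst_Pair red.refl] red.beta])

text \<open>
A redex and the right-hand side of the chain rule for the corresponding substitution meet: the term
of variable 0 is the contribution of the argument, and among the remaining terms, in which
variables are substituted by variables, only the one of \<open>y\<close> survives.
\<close>

lemma pull_beta:
  assumes "y < n"
  shows "\<exists>K. pull y (App (Lam M) N) \<leadsto> K \<and> PLam (chain_sum (Suc n) y M (case_nat N Var)) \<leadsto> K"
proof -
  \<comment> \<open>Under \<open>\<lambda>\<pi>\<close>: the derivative of the body in \<open>y\<close>, plus that in the bound variable bound to that of \<open>N\<close>.\<close>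
  let ?K = "PPlus (PApp (plift (pinst (pull (Suc y) M) (bullet N))) (PVar 0))
     (PBind (PApp (plift (pinst (pull 0 M) (bullet N))) (PVar 0)) (plift (pull y N)))"
  have unc: "PApp (plift (uncurry_abs G)) (PPair (plift (bullet N)) (PVar 0)) \<leadsto>
      PApp (plift (pinst G (bullet N))) (PVar 0)" for G
    unfolding uncurry_abs_pren pren_pinst by (rule uncurry_abs_app_Pair)
  have "PApp (PSnd (plift (PPair A (uncurry_abs G)))) (PPair (plift (bullet N)) (PVar 0)) \<leadsto>
      PApp (plift (pinst G (bullet N))) (PVar 0)" for A G
    unfolding pren.simps by (rule red.trans[OF red.App[OF red.Snd_Pair red.refl] unc])
  then have "pull y (App (Lam M) N) \<leadsto> PLam ?K"
    unfolding bullet_pull_folded pull_of_app_def by (intro red.Lam red.Plus unc red.Bind red.refl)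
  moreover have "PLam (chain_sum (Suc n) y M (case_nat N Var)) \<leadsto> PLam ?K"
  proof (rule red.Lam)
    have "psum n (\<lambda>x. PBind (PApp (plift (pinst (pull (Suc x) M) (bullet N))) (PVar 0)) (plift (pull y (Var x))))
      \<leadsto> PApp (plift (pinst (pull (Suc y) M) (bullet N))) (PVar 0)"
      by (rule psum_single[OF assms]) (simp_all add: red.Bind_Ret red.Bind_Zero)
    then have "PPlus (PBind (PApp (plift (pinst (pull 0 M) (bullet N))) (PVar 0)) (plift (pull y N)))
      (psum n (\<lambda>x. PBind (PApp (plift (pinst (pull (Suc x) M) (bullet N))) (PVar 0)) (plift (pull y (Var x)))))
      \<leadsto> ?K"
      by (rule red.trans[OF red.Plus[OF red.refl] red.Plus_commute])
    then show "chain_sum (Suc n) y M (case_nat N Var) \<leadsto> ?K"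
      by (simp add: chain_sum_def bullet_case_nat pinst_def del: pull.simps)
  qed
  ultimately show ?thesis by blast
qed

lemma typed_case_nat: "typed \<Gamma> N E \<Longrightarrow> x < length (E # \<Gamma>) \<Longrightarrow> typed \<Gamma> (case_nat N Var x) ((E # \<Gamma>) ! x)"
  by (cases x) (auto intro: typed.Var)

theorem dialectica_sound:
  fixes gW gC :: "'g \<Rightarrow> 'p"
  defines "W \<equiv> W_ty gW gC" and "C \<equiv> C_ty gW gC"
  assumes "eqv \<Gamma> M N E"
  shows "peqv (map W \<Gamma>) (bullet M) (bullet N) (W E) \<and>
    (\<forall>y < length \<Gamma>. peqv (map W \<Gamma>) (pull y M) (pull y N) (PArr (C E) (PM (C (\<Gamma> ! y)))))"
  using assms(3)
proof (induction rule: eqv.induct)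
  have bt: "ptyped (map W \<Gamma>) (bullet M) (W E)" if "typed \<Gamma> M E" for \<Gamma> M E
    unfolding W_def by (rule bullet_typed[OF that])
  have pt: "ptyped (map W \<Gamma>) (pull y M) (PArr (C E) (PM (C (\<Gamma> ! y))))"
    if "typed \<Gamma> M E" "y < length \<Gamma>" for \<Gamma> M E y
    unfolding W_def C_def by (rule pull_typed[OF that])
  have W: "W (Arr E F) = PProd (PArr (W E) (W F)) (PArr (PProd (W E) (C F)) (PM (C E)))"
    and C: "C (Arr E F) = PProd (W E) (C F)" for E F
    by (simp_all add: C_def W_def)
  {
    case (refl \<Gamma> M E)
    then show ?case by (simp add: bt pt peqv.refl)
  next
    case (sym \<Gamma> M N E)
    then show ?case by (simp add: peqv.sym)
  next
    case (trans \<Gamma> M N E P)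
    then show ?case by (blast intro: peqv.trans)
  next
    case (Lam E \<Gamma> M M' F)
    have 1: "peqv (W E # map W \<Gamma>) (bullet M) (bullet M') (W F)"
      and 2: "peqv (W E # map W \<Gamma>) (pull 0 M) (pull 0 M') (PArr (C F) (PM (C E)))"
      using Lam.IH by auto
    have 3: "peqv (W E # map W \<Gamma>) (pull (Suc y) M) (pull (Suc y) M') (PArr (C F) (PM (C (\<Gamma> ! y))))"
      if "y < length \<Gamma>" for y using Lam.IH that by (auto dest!: conjunct2 spec[of _ "Suc y"])
    show ?case unfolding bullet_pull_folded W C
      by (intro conjI allI impI peqv.Pair peqv.Lam uncurry_abs_peqv 1 2 3)
  next
    case (App \<Gamma> M M' E F N N')
    then show ?case unfolding bullet_pull_folded bullet.simps(3) W C
      by (blast intro: peqv.App peqv.Fst pull_of_app_peqv)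
  next
    case (beta E \<Gamma> M F N)
    have app: "typed \<Gamma> (App (Lam M) N) F" using beta by (auto intro: typed.intros)
    note sub = chain_rule[OF beta(1) typed_case_nat[OF beta(2)], of gW gC,
        folded W_def C_def inst_def, unfolded bullet_case_nat pinst_def[symmetric]]
    have "peqv (map W \<Gamma>) (bullet (App (Lam M) N)) (bullet (inst M N)) (W F)"
      using red_peqv[OF bullet_beta bt[OF app]] sub by (meson peqv.sym peqv.trans)
    moreover have "peqv (map W \<Gamma>) (pull y (App (Lam M) N)) (pull y (inst M N)) (PArr (C F) (PM (C (\<Gamma> ! y))))"
      if y: "y < length \<Gamma>" for y
    proof -
      obtain K where "pull y (App (Lam M) N) \<leadsto> K" "PLam (chain_sum (Suc (length \<Gamma>)) y M (case_nat N Var)) \<leadsto> K"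
        using pull_beta[OF y] by blast
      moreover have "peqv (map W \<Gamma>) (pull y (inst M N)) (PLam (chain_sum (Suc (length \<Gamma>)) y M (case_nat N Var)))
          (PArr (C F) (PM (C (\<Gamma> ! y))))"
        using sub y by simp
      ultimately show ?thesis using peqv.sym peqv_red_join pt[OF app y] by blast
    qed
    ultimately show ?case by blast
  next
    case (eta \<Gamma> M E F)
    have "typed \<Gamma> (Lam (App (ren M Suc) (Var 0))) (Arr E F)"
      using eqv_typed[OF eqv.eta[OF eta]] by simp
    note t = bt[OF this] pt[OF this]
    have "peqv (map W \<Gamma>) (bullet (Lam (App (ren M Suc) (Var 0)))) (bullet M) (W (Arr E F))"
      using red_peqv[OF bullet_pull_eta(1) t(1)] peqv.surj_Pair[OF bt[OF eta, unfolded W]]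
      unfolding W by (rule peqv.trans)
    then show ?case using red_peqv[OF bullet_pull_eta(2) t(2)] by blast
  }
qed

section \<open>Euclidean lenses and the Euclidean Dialectica category\<close>

lemma functor_comp_is_functor:
  assumes "is_functor L K F" "is_functor K J G"
  shows "is_functor L J (functor_comp F G)"
proof -
  interpret F: is_functor L K F by fact
  interpret G: is_functor K J G by fact
  show ?thesis
  proof
    fix A B C f g assume "A \<in> Ob L" "B \<in> Ob L" "C \<in> Ob L" "f \<in> Hom L A B" "g \<in> Hom L B C"
    then show "on_arr (functor_comp F G) A C (Comp L A B C f g) =
        Comp J (on_ob (functor_comp F G) A) (on_ob (functor_comp F G) B) (on_ob (functor_comp F G) C)
          (on_arr (functor_comp F G) A B f) (on_arr (functor_comp F G) B C g)"
      by (simp add: functor_comp_def F.on_arr_Comp G.on_arr_Comp F.on_ob_in_Ob F.on_arr_in_Hom)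
  qed (simp_all add: functor_comp_def F.on_ob_in_Ob F.on_arr_in_Hom F.on_arr_Idn
      G.on_ob_in_Ob G.on_arr_in_Hom G.on_arr_Idn)
qed

text \<open>
Equations between arrows of \<open>L\<close> may be checked after applying a faithful map that preserves
identities and composition. So the laws of \<open>K\<close> turn \<open>L\<close>, which is closed under the operations, into
a category.
\<close>

lemma faithful_imp_is_functor:
  assumes K: "category K"
    and Idn: "\<And>A. A \<in> Ob L \<Longrightarrow> Idn L A \<in> Hom L A A"
    and Comp: "\<And>A B C f g. \<lbrakk>A \<in> Ob L; B \<in> Ob L; C \<in> Ob L; f \<in> Hom L A B; g \<in> Hom L B C\<rbrakk>
      \<Longrightarrow> Comp L A B C f g \<in> Hom L A C"
    and ob: "\<And>A. A \<in> Ob L \<Longrightarrow> on_ob F A \<in> Ob K"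
    and arr: "\<And>A B f. \<lbrakk>A \<in> Ob L; B \<in> Ob L; f \<in> Hom L A B\<rbrakk>
      \<Longrightarrow> on_arr F A B f \<in> Hom K (on_ob F A) (on_ob F B)"
    and arr_Idn: "\<And>A. A \<in> Ob L \<Longrightarrow> on_arr F A A (Idn L A) = Idn K (on_ob F A)"
    and arr_Comp: "\<And>A B C f g. \<lbrakk>A \<in> Ob L; B \<in> Ob L; C \<in> Ob L; f \<in> Hom L A B; g \<in> Hom L B C\<rbrakk>
      \<Longrightarrow> on_arr F A C (Comp L A B C f g) =
          Comp K (on_ob F A) (on_ob F B) (on_ob F C) (on_arr F A B f) (on_arr F B C g)"
    and faithful: "\<And>A B. \<lbrakk>A \<in> Ob L; B \<in> Ob L\<rbrakk> \<Longrightarrow> inj_on (on_arr F A B) (Hom L A B)"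
  shows "is_functor L K F"
proof -
  interpret K: category K by (rule K)
  note closed = Idn Comp ob arr
  have L: "category L"
  proof
    fix A B f assume *: "A \<in> Ob L" "B \<in> Ob L" "f \<in> Hom L A B"
    show "Comp L A A B (Idn L A) f = f"
      by (rule inj_onD[OF faithful[OF *(1,2)]]) (simp_all add: * closed arr_Comp arr_Idn K.Idn_Comp)
    show "Comp L A B B f (Idn L B) = f"
      by (rule inj_onD[OF faithful[OF *(1,2)]]) (simp_all add: * closed arr_Comp arr_Idn K.Comp_Idn)
  next
    fix A B C D f g h
    assume *: "A \<in> Ob L" "B \<in> Ob L" "C \<in> Ob L" "D \<in> Ob L"
      "f \<in> Hom L A B" "g \<in> Hom L B C" "h \<in> Hom L C D"
    have c: "Comp L A B C f g \<in> Hom L A C" "Comp L B C D g h \<in> Hom L B D"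
      by (rule Comp[OF *(1-3,5,6)], rule Comp[OF *(2-4,6,7)])
    show "Comp L A C D (Comp L A B C f g) h = Comp L A B D f (Comp L B C D g h)"
    proof (rule inj_onD[OF faithful[OF *(1,4)]])
      show "on_arr F A D (Comp L A C D (Comp L A B C f g) h) = on_arr F A D (Comp L A B D f (Comp L B C D g h))"
        using * c by (simp add: arr_Comp ob arr K.Comp_assoc)
    qed (use * c Comp in blast)+
  qed (fact Idn Comp)+
  show ?thesis
    by (intro is_functor.intro is_functor_axioms.intro L K ob arr arr_Idn arr_Comp)
qed

context category_with_products
begin

lemma tuple_props:
  assumes "C \<in> Ob L" "A \<in> Ob L" "B \<in> Ob L" "f \<in> Hom L C A" "g \<in> Hom L C B"
  shows "tuple L C A B f g \<in> Hom L C (Prod L A B)"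
    and "Comp L C (Prod L A B) A (tuple L C A B f g) (Pr1 L A B) = f"
    and "Comp L C (Prod L A B) B (tuple L C A B f g) (Pr2 L A B) = g"
  using theI'[OF universal[OF assms], folded tuple_def] by auto

lemma prod_eqI:
  assumes "C \<in> Ob L" "A \<in> Ob L" "B \<in> Ob L" "h \<in> Hom L C (Prod L A B)" "k \<in> Hom L C (Prod L A B)"
    and "Comp L C (Prod L A B) A h (Pr1 L A B) = Comp L C (Prod L A B) A k (Pr1 L A B)"
    and "Comp L C (Prod L A B) B h (Pr2 L A B) = Comp L C (Prod L A B) B k (Pr2 L A B)"
  shows "h = k"
proof -
  have "Comp L C (Prod L A B) A k (Pr1 L A B) \<in> Hom L C A" "Comp L C (Prod L A B) B k (Pr2 L A B) \<in> Hom L C B"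
    using assms by (auto intro!: Comp_in_Hom Prod_in_Ob Pr1_in_Hom Pr2_in_Hom)
  from universal[OF assms(1-3) this] show ?thesis using assms by blast
qed

lemma times_id_props:
  assumes "A \<in> Ob L" "B \<in> Ob L" "Y \<in> Ob L" "f \<in> Hom L A B"
  shows "times_id L A B Y f \<in> Hom L (Prod L A Y) (Prod L B Y)"
    and "Comp L (Prod L A Y) (Prod L B Y) B (times_id L A B Y f) (Pr1 L B Y) =
      Comp L (Prod L A Y) A B (Pr1 L A Y) f"
    and "Comp L (Prod L A Y) (Prod L B Y) Y (times_id L A B Y f) (Pr2 L B Y) = Pr2 L A Y"
proof -
  have "Comp L (Prod L A Y) A B (Pr1 L A Y) f \<in> Hom L (Prod L A Y) B"
    using assms by (auto intro!: Comp_in_Hom Prod_in_Ob Pr1_in_Hom)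
  note t = tuple_props[OF Prod_in_Ob[OF assms(1,3)] assms(2,3) this Pr2_in_Hom[OF assms(1,3)], folded times_id_def]
  show "times_id L A B Y f \<in> Hom L (Prod L A Y) (Prod L B Y)"
    and "Comp L (Prod L A Y) (Prod L B Y) B (times_id L A B Y f) (Pr1 L B Y) =
      Comp L (Prod L A Y) A B (Pr1 L A Y) f"
    and "Comp L (Prod L A Y) (Prod L B Y) Y (times_id L A B Y f) (Pr2 L B Y) = Pr2 L A Y"
    by (rule t)+
qed

lemmas hom_rules = Prod_in_Ob Pr1_in_Hom Pr2_in_Hom tuple_props(1) times_id_props(1) Idn_in_Hom

lemma times_id_Idn:
  assumes "A \<in> Ob L" "X \<in> Ob L"
  shows "times_id L A A X (Idn L A) = Idn L (Prod L A X)"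
  using assms
  by - (rule prod_eqI[of "Prod L A X" A X];
    simp add: hom_rules times_id_props Comp_Idn Idn_Comp)

lemma tuple_Pr1_Pr2:
  assumes "A \<in> Ob L" "X \<in> Ob L"
  shows "tuple L (Prod L A X) A X (Pr1 L A X) (Pr2 L A X) = Idn L (Prod L A X)"
  using assms
  by - (rule prod_eqI[of "Prod L A X" A X];
    simp add: hom_rules tuple_props Idn_Comp)

lemma times_id_Comp:
  assumes "A \<in> Ob L" "B \<in> Ob L" "C \<in> Ob L" "Z \<in> Ob L" "f \<in> Hom L A B" "g \<in> Hom L B C"
  shows "Comp L (Prod L A Z) (Prod L B Z) (Prod L C Z) (times_id L A B Z f) (times_id L B C Z g) =
    times_id L A C Z (Comp L A B C f g)"
proof (rule prod_eqI[of "Prod L A Z" C Z])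
  note [simp] = assms hom_rules times_id_props
  have fg: "Comp L A B C f g \<in> Hom L A C" by (rule Comp_in_Hom[OF assms(1-3,5,6)])
  note c = Comp_in_Hom[of _ "Prod L B Z" "Prod L C Z"]
  show "Comp L (Prod L A Z) (Prod L B Z) (Prod L C Z) (times_id L A B Z f) (times_id L B C Z g)
    \<in> Hom L (Prod L A Z) (Prod L C Z)" by (rule c) simp_all
  show "times_id L A C Z (Comp L A B C f g) \<in> Hom L (Prod L A Z) (Prod L C Z)" using fg by simp
  show "Comp L (Prod L A Z) (Prod L C Z) C
      (Comp L (Prod L A Z) (Prod L B Z) (Prod L C Z) (times_id L A B Z f) (times_id L B C Z g)) (Pr1 L C Z) =
    Comp L (Prod L A Z) (Prod L C Z) C (times_id L A C Z (Comp L A B C f g)) (Pr1 L C Z)"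
  proof -
    have "Comp L (Prod L A Z) (Prod L C Z) C
      (Comp L (Prod L A Z) (Prod L B Z) (Prod L C Z) (times_id L A B Z f) (times_id L B C Z g)) (Pr1 L C Z) =
      Comp L (Prod L A Z) (Prod L B Z) C (times_id L A B Z f) (Comp L (Prod L B Z) B C (Pr1 L B Z) g)"
      by (subst Comp_assoc) simp_all
    also have "\<dots> = Comp L (Prod L A Z) B C (Comp L (Prod L A Z) A B (Pr1 L A Z) f) g"
      by (subst Comp_assoc[symmetric]) simp_all
    finally show ?thesis using fg by (simp add: Comp_assoc)
  qed
  show "Comp L (Prod L A Z) (Prod L C Z) Z
      (Comp L (Prod L A Z) (Prod L B Z) (Prod L C Z) (times_id L A B Z f) (times_id L B C Z g)) (Pr2 L C Z) =
    Comp L (Prod L A Z) (Prod L C Z) Z (times_id L A C Z (Comp L A B C f g)) (Pr2 L C Z)"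
    using fg by (subst Comp_assoc) simp_all
qed (simp_all add: assms hom_rules)

text \<open>
Associativity comes down to one naturality square: with \<open>K = \<langle>\<pi>\<^sub>1, k\<rangle>\<close> and \<open>M = \<langle>\<pi>\<^sub>1, l\<rangle>\<close> the
re-indexings that the composites with the last arrow produce, \<open>K;(f \<times> 1) = (f \<times> 1);M\<close>.
\<close>

lemma EDial_category: "category (EDial L)"
proof
  fix P assume "P \<in> Ob (EDial L)"
  then show "Idn (EDial L) P \<in> Hom (EDial L) P P"
    by (auto simp: EDial_def hom_rules)
next
  fix P Q R u v assume "P \<in> Ob (EDial L)" "Q \<in> Ob (EDial L)" "R \<in> Ob (EDial L)"
    "u \<in> Hom (EDial L) P Q" "v \<in> Hom (EDial L) Q R"
  then obtain A X B Y C Z f F g G where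
    P: "P = (A, X, Idn L (Prod L A X))" "Q = (B, Y, Idn L (Prod L B Y))" "R = (C, Z, Idn L (Prod L C Z))"
    and o: "A \<in> Ob L" "X \<in> Ob L" "B \<in> Ob L" "Y \<in> Ob L" "C \<in> Ob L" "Z \<in> Ob L"
    and u: "u = (f, F)" "v = (g, G)"
    and h: "f \<in> Hom L A B" "g \<in> Hom L B C" "F \<in> Hom L (Prod L A Y) X" "G \<in> Hom L (Prod L B Z) Y"
    by (auto simp: EDial_def)
  show "Comp (EDial L) P Q R u v \<in> Hom (EDial L) P R"
    unfolding EDial_def P u
    by simp (intro conjI Comp_in_Hom[of A B C] Comp_in_Hom[of "Prod L A Z" "Prod L A Y" X]
        Comp_in_Hom[of "Prod L A Z" "Prod L B Z" Y] hom_rules(1-5) o h)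
next
  fix P Q u assume "P \<in> Ob (EDial L)" "Q \<in> Ob (EDial L)" "u \<in> Hom (EDial L) P Q"
  then obtain A X B Y f F where
    P: "P = (A, X, Idn L (Prod L A X))" "Q = (B, Y, Idn L (Prod L B Y))"
    and o: "A \<in> Ob L" "X \<in> Ob L" "B \<in> Ob L" "Y \<in> Ob L"
    and u: "u = (f, F)" and h: "f \<in> Hom L A B" "F \<in> Hom L (Prod L A Y) X"
    by (auto simp: EDial_def)
  show "Comp (EDial L) P P Q (Idn (EDial L) P) u = u"
    unfolding EDial_def P u
    by (simp add: o h hom_rules times_id_Idn Idn_Comp tuple_props)
  show "Comp (EDial L) P Q Q u (Idn (EDial L) Q) = u"
    unfolding EDial_def P u
    by (simp add: o h hom_rules times_id_props Comp_Idn Idn_Comp tuple_Pr1_Pr2)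
next
  fix P Q R S u v w assume "P \<in> Ob (EDial L)" "Q \<in> Ob (EDial L)" "R \<in> Ob (EDial L)" "S \<in> Ob (EDial L)"
    "u \<in> Hom (EDial L) P Q" "v \<in> Hom (EDial L) Q R" "w \<in> Hom (EDial L) R S"
  then obtain A X B Y C Z D V f F g G h H where
    P: "P = (A, X, Idn L (Prod L A X))" "Q = (B, Y, Idn L (Prod L B Y))" "R = (C, Z, Idn L (Prod L C Z))"
      "S = (D, V, Idn L (Prod L D V))"
    and o: "A \<in> Ob L" "X \<in> Ob L" "B \<in> Ob L" "Y \<in> Ob L" "C \<in> Ob L" "Z \<in> Ob L" "D \<in> Ob L" "V \<in> Ob L"
    and u: "u = (f, F)" "v = (g, G)" "w = (h, H)"
    and h: "f \<in> Hom L A B" "g \<in> Hom L B C" "h \<in> Hom L C D" "F \<in> Hom L (Prod L A Y) X"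
      "G \<in> Hom L (Prod L B Z) Y" "H \<in> Hom L (Prod L C V) Z"
    by (auto simp: EDial_def)
  note [simp] = o h
  let ?AV = "Prod L A V" and ?BV = "Prod L B V" and ?CV = "Prod L C V"
    and ?AZ = "Prod L A Z" and ?BZ = "Prod L B Z" and ?AY = "Prod L A Y"
  let ?fg = "Comp L A B C f g"
  have O [simp]: "?AV \<in> Ob L" "?BV \<in> Ob L" "?CV \<in> Ob L" "?AZ \<in> Ob L" "?BZ \<in> Ob L" "?AY \<in> Ob L"
    by (simp_all add: Prod_in_Ob)
  have fg [simp]: "?fg \<in> Hom L A C" by (rule Comp_in_Hom[of A B C]) simp_all
  define k where "k = Comp L ?AV ?CV Z (times_id L A C V ?fg) H"
  define l where "l = Comp L ?BV ?CV Z (times_id L B C V g) H"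
  \<comment> \<open>The arrow \<open>k\<close> into \<open>Z\<close> comes from the left-hand side and \<open>l\<close> from the right-hand side.\<close>
  have kl: "k = Comp L ?AV ?BV Z (times_id L A B V f) l"
    unfolding k_def l_def
    by (subst times_id_Comp[symmetric]; simp?; subst Comp_assoc; simp add: times_id_props)
  have [simp]: "k \<in> Hom L ?AV Z" "l \<in> Hom L ?BV Z"
    unfolding k_def l_def by (rule Comp_in_Hom[of _ ?CV]; simp add: times_id_props)+
  define K where "K = tuple L ?AV A Z (Pr1 L A V) k"
  define M where "M = tuple L ?BV B Z (Pr1 L B V) l"
  have K [simp]: "K \<in> Hom L ?AV ?AZ" "Comp L ?AV ?AZ A K (Pr1 L A Z) = Pr1 L A V"
      "Comp L ?AV ?AZ Z K (Pr2 L A Z) = k"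
    unfolding K_def by (simp_all add: tuple_props Pr1_in_Hom)
  have M [simp]: "M \<in> Hom L ?BV ?BZ" "Comp L ?BV ?BZ B M (Pr1 L B Z) = Pr1 L B V"
      "Comp L ?BV ?BZ Z M (Pr2 L B Z) = l"
    unfolding M_def by (simp_all add: tuple_props Pr1_in_Hom)
  have square: "Comp L ?AV ?AZ ?BZ K (times_id L A B Z f) = Comp L ?AV ?BV ?BZ (times_id L A B V f) M"
  proof (rule prod_eqI[of ?AV B Z])
    show "Comp L ?AV ?AZ ?BZ K (times_id L A B Z f) \<in> Hom L ?AV ?BZ"
      by (rule Comp_in_Hom[of _ ?AZ]) (simp_all add: times_id_props)
    show "Comp L ?AV ?BV ?BZ (times_id L A B V f) M \<in> Hom L ?AV ?BZ"
      by (rule Comp_in_Hom[of _ ?BV]) (simp_all add: times_id_props)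
    have "Comp L ?AV ?BZ B (Comp L ?AV ?AZ ?BZ K (times_id L A B Z f)) (Pr1 L B Z) =
        Comp L ?AV ?AZ B K (Comp L ?AZ A B (Pr1 L A Z) f)"
      by (subst Comp_assoc) (simp_all add: times_id_props Pr1_in_Hom)
    also have "\<dots> = Comp L ?AV A B (Pr1 L A V) f"
      by (subst Comp_assoc[symmetric]) (simp_all add: Pr1_in_Hom)
    also have "\<dots> = Comp L ?AV ?BZ B (Comp L ?AV ?BV ?BZ (times_id L A B V f) M) (Pr1 L B Z)"
      by (subst Comp_assoc) (simp_all add: times_id_props Pr1_in_Hom)
    finally show "Comp L ?AV ?BZ B (Comp L ?AV ?AZ ?BZ K (times_id L A B Z f)) (Pr1 L B Z) =
        Comp L ?AV ?BZ B (Comp L ?AV ?BV ?BZ (times_id L A B V f) M) (Pr1 L B Z)" .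
    show "Comp L ?AV ?BZ Z (Comp L ?AV ?AZ ?BZ K (times_id L A B Z f)) (Pr2 L B Z) =
        Comp L ?AV ?BZ Z (Comp L ?AV ?BV ?BZ (times_id L A B V f) M) (Pr2 L B Z)"
      by (simp add: Comp_assoc times_id_props Pr2_in_Hom kl)
  qed simp_all
  define n where "n = Comp L ?AZ ?BZ Y (times_id L A B Z f) G"
  define m where "m = Comp L ?BV ?BZ Y M G"
  have [simp]: "n \<in> Hom L ?AZ Y" unfolding n_def by (rule Comp_in_Hom[of _ ?BZ]) (simp_all add: times_id_props)
  have [simp]: "m \<in> Hom L ?BV Y" unfolding m_def by (rule Comp_in_Hom[of _ ?BZ]) simp_all
  have fm [simp]: "Comp L ?AV ?BV Y (times_id L A B V f) m \<in> Hom L ?AV Y"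
    by (rule Comp_in_Hom[of _ ?BV]) (simp_all add: times_id_props)
  have Kn: "Comp L ?AV ?AZ Y K n = Comp L ?AV ?BV Y (times_id L A B V f) m"
    unfolding n_def m_def
    by (simp add: Comp_assoc[symmetric] times_id_props square)
  have Kt: "Comp L ?AV ?AZ ?AY K (tuple L ?AZ A Y (Pr1 L A Z) n) =
      tuple L ?AV A Y (Pr1 L A V) (Comp L ?AV ?BV Y (times_id L A B V f) m)"
  proof (rule prod_eqI[of ?AV A Y])
    show "Comp L ?AV ?AZ ?AY K (tuple L ?AZ A Y (Pr1 L A Z) n) \<in> Hom L ?AV ?AY"
      by (rule Comp_in_Hom[of _ ?AZ]) (simp_all add: tuple_props Pr1_in_Hom)
  qed (simp_all add: tuple_props Pr1_in_Hom Pr2_in_Hom Comp_assoc Kn)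
  have "Comp L ?AV ?AZ X K (Comp L ?AZ ?AY X (tuple L ?AZ A Y (Pr1 L A Z) n) F) =
      Comp L ?AV ?AY X (tuple L ?AV A Y (Pr1 L A V) (Comp L ?AV ?BV Y (times_id L A B V f) m)) F"
    by (simp add: Comp_assoc[symmetric] tuple_props Pr1_in_Hom Kt)
  then show "Comp (EDial L) P R S (Comp (EDial L) P Q R u v) w =
      Comp (EDial L) P Q S u (Comp (EDial L) Q R S v w)"
    unfolding EDial_def P u
    by (simp add: Comp_assoc K_def M_def k_def l_def m_def n_def)
qed

text \<open>
Faithful because the left leg of a lens is a map into a product whose first component is fixed.
\<close>

lemma ELens_to_EDial_functor: "is_functor (ELens L) (EDial L) (ELens_to_EDial L)"
proof (rule faithful_imp_is_functor[OF EDial_category])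
  fix P assume "P \<in> Ob (ELens L)"
  then show "Idn (ELens L) P \<in> Hom (ELens L) P P"
    by (auto simp: ELens_def hom_rules times_id_Idn Idn_Comp)
next
  fix P Q R u v assume "P \<in> Ob (ELens L)" "Q \<in> Ob (ELens L)" "R \<in> Ob (ELens L)"
    "u \<in> Hom (ELens L) P Q" "v \<in> Hom (ELens L) Q R"
  then obtain A X B Y C Z f F g G where
    P: "P = (A, X, Pr1 L A X)" "Q = (B, Y, Pr1 L B Y)" "R = (C, Z, Pr1 L C Z)"
    and o: "A \<in> Ob L" "X \<in> Ob L" "B \<in> Ob L" "Y \<in> Ob L" "C \<in> Ob L" "Z \<in> Ob L"
    and u: "u = (f, (F, times_id L A B Y f))" "v = (g, (G, times_id L B C Z g))"
    and h: "f \<in> Hom L A B" "g \<in> Hom L B C" "F \<in> Hom L (Prod L A Y) (Prod L A X)"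
      "G \<in> Hom L (Prod L B Z) (Prod L B Y)"
    and F: "Comp L (Prod L A Y) (Prod L A X) A F (Pr1 L A X) = Pr1 L A Y"
    by (auto simp: ELens_def)
  define GY where "GY = Comp L (Prod L A Z) (Prod L B Z) Y (times_id L A B Z f)
                  (Comp L (Prod L B Z) (Prod L B Y) Y G (Pr2 L B Y))"
  have GY: "GY \<in> Hom L (Prod L A Z) Y" unfolding GY_def
    by (intro Comp_in_Hom[of "Prod L A Z" "Prod L B Z" Y] Comp_in_Hom[of "Prod L B Z" "Prod L B Y" Y]
        hom_rules(1-5) o h)
  define t where "t = tuple L (Prod L A Z) A Y (Pr1 L A Z) GY"
  have t: "t \<in> Hom L (Prod L A Z) (Prod L A Y)" "Comp L (Prod L A Z) (Prod L A Y) A t (Pr1 L A Y) = Pr1 L A Z"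
    unfolding t_def by (simp_all add: tuple_props o Prod_in_Ob Pr1_in_Hom GY)
  have tF: "Comp L (Prod L A Z) (Prod L A Y) (Prod L A X) t F \<in> Hom L (Prod L A Z) (Prod L A X)"
    by (rule Comp_in_Hom[of _ "Prod L A Y"]) (simp_all add: o h t Prod_in_Ob)
  have fg: "Comp L A B C f g \<in> Hom L A C" by (rule Comp_in_Hom[of A B C]) (simp_all add: o h)
  show "Comp (ELens L) P Q R u v \<in> Hom (ELens L) P R"
    unfolding ELens_def P u
    by (simp add: Let_def fg tF GY_def[symmetric] t_def[symmetric])
      (simp add: Comp_assoc o h t Prod_in_Ob Pr1_in_Hom F)
  show "on_arr (ELens_to_EDial L) P R (Comp (ELens L) P Q R u v) =
    Comp (EDial L) (on_ob (ELens_to_EDial L) P) (on_ob (ELens_to_EDial L) Q) (on_ob (ELens_to_EDial L) R)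
     (on_arr (ELens_to_EDial L) P Q u) (on_arr (ELens_to_EDial L) Q R v)"
    unfolding ELens_def EDial_def ELens_to_EDial_def P u
    by (simp add: Let_def GY_def[symmetric] t_def[symmetric])
      (simp add: Comp_assoc o h t Prod_in_Ob Pr2_in_Hom)
next
  fix P assume "P \<in> Ob (ELens L)"
  then show "on_ob (ELens_to_EDial L) P \<in> Ob (EDial L)"
    by (auto simp: ELens_def EDial_def ELens_to_EDial_def)
next
  fix P Q u assume "P \<in> Ob (ELens L)" "Q \<in> Ob (ELens L)" "u \<in> Hom (ELens L) P Q"
  then show "on_arr (ELens_to_EDial L) P Q u \<in> Hom (EDial L) (on_ob (ELens_to_EDial L) P) (on_ob (ELens_to_EDial L) Q)"
    by (auto simp: ELens_def EDial_def ELens_to_EDial_def intro!: Comp_in_Hom Prod_in_Ob Pr2_in_Hom)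
next
  fix P assume "P \<in> Ob (ELens L)"
  then show "on_arr (ELens_to_EDial L) P P (Idn (ELens L) P) = Idn (EDial L) (on_ob (ELens_to_EDial L) P)"
    by (auto simp: ELens_def EDial_def ELens_to_EDial_def hom_rules Idn_Comp)
next
  fix P Q assume "P \<in> Ob (ELens L)" "Q \<in> Ob (ELens L)"
  then obtain A X B Y where P: "P = (A, X, Pr1 L A X)" "Q = (B, Y, Pr1 L B Y)"
    and o: "A \<in> Ob L" "X \<in> Ob L" "B \<in> Ob L" "Y \<in> Ob L"
    by (auto simp: ELens_def)
  have "F = F'" if "F \<in> Hom L (Prod L A Y) (Prod L A X)" "F' \<in> Hom L (Prod L A Y) (Prod L A X)"
    "Comp L (Prod L A Y) (Prod L A X) A F (Pr1 L A X) = Pr1 L A Y"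
    "Comp L (Prod L A Y) (Prod L A X) A F' (Pr1 L A X) = Pr1 L A Y"
    "Comp L (Prod L A Y) (Prod L A X) X F (Pr2 L A X) = Comp L (Prod L A Y) (Prod L A X) X F' (Pr2 L A X)"
    for F F'
    by (rule prod_eqI[of "Prod L A Y" A X]) (simp_all add: that o Prod_in_Ob)
  then show "inj_on (on_arr (ELens_to_EDial L) P Q) (Hom (ELens L) P Q)"
    unfolding P ELens_def ELens_to_EDial_def by (auto intro!: inj_onI)
qed

end

section \<open>The syntactic categories\<close>

lemma cls_eq: "eqv [A] M N B \<Longrightarrow> cls A M B = cls A N B"
  unfolding cls_def by (blast intro: eqv.sym eqv.trans)

text \<open>
The operations on classes are unions over all representatives; they may be computed on one
representative as soon as the class of the result does not depend on it.
\<close>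

lemma UN_cls:
  assumes "typed [A] M B" "\<And>N. eqv [A] M N B \<Longrightarrow> g N = g M"
  shows "(\<Union>N\<in>cls A M B. g N) = g M"
proof (rule SUP_eq_const)
  show "cls A M B \<noteq> {}" using eqv.refl[OF assms(1)] by (auto simp: cls_def)
qed (simp add: cls_def assms(2))

lemma pcls_eq: "peqv [A] M N B \<Longrightarrow> pcls A M B = pcls A N B"
  unfolding pcls_def by (blast intro: peqv.sym peqv.trans)

lemma pcls_eqD: "pcls A M B = pcls A N B \<Longrightarrow> ptyped [A] N B \<Longrightarrow> peqv [A] M N B"
  unfolding pcls_def using peqv.refl by blast

lemma UN_pcls:
  assumes "ptyped [A] M B" "\<And>N. peqv [A] M N B \<Longrightarrow> g N = g M"
  shows "(\<Union>N\<in>pcls A M B. g N) = g M"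
proof (rule SUP_eq_const)
  show "pcls A M B \<noteq> {}" using peqv.refl[OF assms(1)] by (auto simp: pcls_def)
qed (simp add: pcls_def assms(2))

lemma inst_Var0: "inst (Var 0) M = M"
  by (simp add: inst_def)

lemma inst_id: "typed [A] M B \<Longrightarrow> inst M (Var 0) = M"
  unfolding inst_def using sub_cong_typed[of "[A]" M B "case_nat (Var 0) Var" Var] by simp

lemma inst_assoc: "typed [C] P D \<Longrightarrow> inst (inst P N) M = inst P (inst N M)"
  unfolding inst_def by (simp add: sub_sub) (erule sub_cong_typed, simp)

lemma pinst_id: "ptyped [A] M B \<Longrightarrow> pinst M (PVar 0) = M"
  unfolding pinst_def using psub_cong_typed[of "[A]" M B "case_nat (PVar 0) PVar" PVar] by simp

lemma pinst_assoc: "ptyped [C] P D \<Longrightarrow> pinst (pinst P N) M = pinst P (pinst N M)"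
  unfolding pinst_def by (simp add: psub_psub) (erule psub_cong_typed, simp)

lemma typed_inst1: "typed [B] M C \<Longrightarrow> typed [A] N B \<Longrightarrow> typed [A] (inst M N) C"
  using typed_weaken[of "[B]" M C "[A]"] by (simp add: typed_inst)

lemma STLC_Comp:
  assumes "typed [A] M B" "typed [B] N C"
  shows "Comp STLC_cat A B C (cls A M B) (cls B N C) = cls A (inst N M) C"
proof -
  have "(\<Union>N'\<in>cls B N C. cls A (inst N' M') C) = cls A (inst N M') C" if "typed [A] M' B" for M'
    by (rule UN_cls[OF assms(2)]) (meson cls_eq eqv.refl eqv.sym eqv_inst that)
  then have "(\<Union>M'\<in>cls A M B. \<Union>N'\<in>cls B N C. cls A (inst N' M') C) =
      (\<Union>M'\<in>cls A M B. cls A (inst N M') C)"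
    using eqv_typed by (fastforce simp: cls_def[of A M B])
  also have "\<dots> = cls A (inst N M) C"
    by (rule UN_cls[OF assms(1)]) (meson cls_eq eqv.refl eqv.sym eqv_inst assms(2))
  finally show ?thesis by (simp add: STLC_cat_def)
qed

lemma P_Comp:
  assumes "ptyped [A] M B" "ptyped [B] N C"
  shows "Comp P_cat A B C (pcls A M B) (pcls B N C) = pcls A (pinst N M) C"
proof -
  have "(\<Union>N'\<in>pcls B N C. pcls A (pinst N' M') C) = pcls A (pinst N M') C" if "ptyped [A] M' B" for M'
    by (rule UN_pcls[OF assms(2)]) (meson pcls_eq peqv.refl peqv.sym peqv_pinst that)
  then have "(\<Union>M'\<in>pcls A M B. \<Union>N'\<in>pcls B N C. pcls A (pinst N' M') C) =
      (\<Union>M'\<in>pcls A M B. pcls A (pinst N M') C)"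
    using peqv_typed by (fastforce simp: pcls_def[of A M B])
  also have "\<dots> = pcls A (pinst N M) C"
    by (rule UN_pcls[OF assms(1)]) (meson pcls_eq peqv.refl peqv.sym peqv_pinst assms(2))
  finally show ?thesis by (simp add: P_cat_def)
qed

lemma Hom_STLC: "f \<in> Hom STLC_cat A B \<longleftrightarrow> (\<exists>M. typed [A] M B \<and> f = cls A M B)"
  by (auto simp: STLC_cat_def)

lemma Idn_STLC: "Idn STLC_cat A = cls A (Var 0) A"
  by (simp add: STLC_cat_def)

lemma Hom_P: "f \<in> Hom P_cat A B \<longleftrightarrow> (\<exists>M. ptyped [A] M B \<and> f = pcls A M B)"
  by (auto simp: P_cat_def)

lemma pcls_in_Hom: "ptyped [A] M B \<Longrightarrow> pcls A M B \<in> Hom P_cat A B"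
  by (auto simp: Hom_P)

lemma P_simps:
  "Ob P_cat = UNIV" "Idn P_cat A = pcls A (PVar 0) A" "Prod P_cat = PProd"
  "Pr1 P_cat A B = pcls (PProd A B) (PFst (PVar 0)) A"
  "Pr2 P_cat A B = pcls (PProd A B) (PSnd (PVar 0)) B"
  by (simp_all add: P_cat_def)

lemma typed_Var0: "typed [A] (Var 0) A"
  using typed.Var[of 0 "[A]"] by simp

lemma STLC_category: "category STLC_cat"
proof
  show "Idn STLC_cat A \<in> Hom STLC_cat A A" for A :: "'g ty"
    using typed_Var0 by (auto simp: Hom_STLC Idn_STLC)
  show "Comp STLC_cat A B C f g \<in> Hom STLC_cat A C"
    if "f \<in> Hom STLC_cat A B" "g \<in> Hom STLC_cat B C" for A B C :: "'g ty" and f g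
    using that by (auto simp: Hom_STLC STLC_Comp intro: typed_inst1)
  show "Comp STLC_cat A A B (Idn STLC_cat A) f = f" "Comp STLC_cat A B B f (Idn STLC_cat B) = f"
    if "f \<in> Hom STLC_cat A B" for A B :: "'g ty" and f
    using that by (auto simp: Hom_STLC Idn_STLC STLC_Comp typed_Var0 inst_id inst_Var0)
  show "Comp STLC_cat A C D (Comp STLC_cat A B C f g) h = Comp STLC_cat A B D f (Comp STLC_cat B C D g h)"
    if "f \<in> Hom STLC_cat A B" "g \<in> Hom STLC_cat B C" "h \<in> Hom STLC_cat C D" for A B C D :: "'g ty" and f g h
    using that by (auto simp: Hom_STLC STLC_Comp typed_inst1 inst_assoc)
qed

lemma P_category: "category P_cat"
proof
  show "Idn P_cat A \<in> Hom P_cat A A" for A :: "'p pty"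
    using ptyped_PVar0 by (auto simp: Hom_P P_simps)
  show "Comp P_cat A B C f g \<in> Hom P_cat A C"
    if "f \<in> Hom P_cat A B" "g \<in> Hom P_cat B C" for A B C :: "'p pty" and f g
    using that by (auto simp: Hom_P P_Comp intro: ptyped_pinst1)
  show "Comp P_cat A A B (Idn P_cat A) f = f" "Comp P_cat A B B f (Idn P_cat B) = f"
    if "f \<in> Hom P_cat A B" for A B :: "'p pty" and f
    using that by (auto simp: Hom_P P_simps P_Comp ptyped_PVar0 pinst_id)
  show "Comp P_cat A C D (Comp P_cat A B C f g) h = Comp P_cat A B D f (Comp P_cat B C D g h)"
    if "f \<in> Hom P_cat A B" "g \<in> Hom P_cat B C" "h \<in> Hom P_cat C D" for A B C D :: "'p pty" and f g h
    using that by (auto simp: Hom_P P_Comp ptyped_pinst1 pinst_assoc)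
qed

lemma P_pairing:
  assumes M: "ptyped [C] M A" and N: "ptyped [C] N B"
  shows "\<exists>!h. h \<in> Hom P_cat C (Prod P_cat A B)
      \<and> Comp P_cat C (Prod P_cat A B) A h (Pr1 P_cat A B) = pcls C M A
      \<and> Comp P_cat C (Prod P_cat A B) B h (Pr2 P_cat A B) = pcls C N B"
    and "tuple P_cat C A B (pcls C M A) (pcls C N B) = pcls C (PPair M N) (PProd A B)"
proof -
  let ?P = "\<lambda>h. h \<in> Hom P_cat C (Prod P_cat A B)
      \<and> Comp P_cat C (Prod P_cat A B) A h (Pr1 P_cat A B) = pcls C M A
      \<and> Comp P_cat C (Prod P_cat A B) B h (Pr2 P_cat A B) = pcls C N B"
  have pr: "ptyped [PProd A B] (PFst (PVar 0)) A" "ptyped [PProd A B] (PSnd (PVar 0)) B"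
    by (rule ptyped_rules)+
  have MN: "ptyped [C] (PPair M N) (PProd A B)" by (rule ptyped.Pair[OF M N])
  have 1: "?P (pcls C (PPair M N) (PProd A B))"
    using pcls_in_Hom[OF MN] pcls_eq[OF peqv.Fst_Pair[OF M N]] pcls_eq[OF peqv.Snd_Pair[OF M N]] MN
    by (simp add: P_simps P_Comp pr)
  have 2: "h = pcls C (PPair M N) (PProd A B)" if "?P h" for h
  proof -
    obtain K where K: "ptyped [C] K (PProd A B)" "h = pcls C K (PProd A B)"
      using \<open>?P h\<close> by (auto simp: Hom_P P_simps)
    have "pcls C (PFst K) A = pcls C M A" "pcls C (PSnd K) B = pcls C N B"
      using \<open>?P h\<close> unfolding K(2) P_simps P_Comp[OF K(1) pr(1)] P_Comp[OF K(1) pr(2)] pinst_simps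
      by blast+
    note pcls_eqD[OF this(1) M] pcls_eqD[OF this(2) N]
    then have "peqv [C] K (PPair M N) (PProd A B)"
      using peqv.surj_Pair[OF K(1)] by (meson peqv.Pair peqv.sym peqv.trans)
    then show ?thesis unfolding K(2) by (rule pcls_eq)
  qed
  show ex1: "\<exists>!h. ?P h" by (rule ex1I[of ?P, OF 1 2])
  show "tuple P_cat C A B (pcls C M A) (pcls C N B) = pcls C (PPair M N) (PProd A B)"
    unfolding tuple_def by (rule the1_equality[OF ex1 1])
qed

lemma P_category_with_products: "category_with_products (P_cat :: ('p pty, ptm set) prod_cat)"
proof (intro category_with_products.intro category_with_products_axioms.intro P_category)
  fix A B C :: "'p pty" and f g assume "f \<in> Hom P_cat C A" "g \<in> Hom P_cat C B"
  then obtain M N where M: "ptyped [C] M A" and N: "ptyped [C] N B" and fg: "f = pcls C M A" "g = pcls C N B"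
    by (auto simp: Hom_P)
  show "\<exists>!h. h \<in> Hom P_cat C (Prod P_cat A B)
      \<and> Comp P_cat C (Prod P_cat A B) A h (Pr1 P_cat A B) = f
      \<and> Comp P_cat C (Prod P_cat A B) B h (Pr2 P_cat A B) = g"
    unfolding fg by (rule P_pairing(1)[OF M N])
qed (auto simp: Hom_P P_simps intro!: exI ptyped_rules)

lemma P_times_id:
  assumes "ptyped [A] M B"
  shows "times_id P_cat A B Y (pcls A M B) =
    pcls (PProd A Y) (PPair (pinst M (PFst (PVar 0))) (PSnd (PVar 0))) (PProd B Y)"
proof -
  have pr: "ptyped [PProd A Y] (PFst (PVar 0)) A" "ptyped [PProd A Y] (PSnd (PVar 0)) Y"
    by (rule ptyped_rules)+
  show ?thesis unfolding times_id_def P_simps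
    by (simp add: P_Comp[OF pr(1) assms] P_pairing(2)[OF ptyped_pinst1[OF assms pr(1)] pr(2)])
qed

section \<open>The functor into Euclidean lenses\<close>

text \<open>
The second component \<open>z\<^sup>2 >>= M\<^sub>x{z\<^sup>1/x}\<close> of the left leg of the lens of \<open>M\<close>.
\<close>

definition lens_put :: "tm \<Rightarrow> ptm" where
  "lens_put M = PBind (PSnd (PVar 0)) (pinst (pull 0 M) (PFst (PVar 0)))"

context
  fixes gW gC :: "'g \<Rightarrow> 'p"
begin

abbreviation (input) "WT \<equiv> W_ty gW gC"
abbreviation (input) "CT \<equiv> C_ty gW gC"

lemma bullet_typed1: "typed [A] M B \<Longrightarrow> ptyped [WT A] (bullet M) (WT B)"
  using bullet_typed[of "[A]" M B gW gC] by simp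

lemma pull_typed1: "typed [A] M B \<Longrightarrow> ptyped [WT A] (pull 0 M) (PArr (CT B) (PM (CT A)))"
  using pull_typed[of "[A]" M B 0 gW gC] by simp

lemma bullet_sound1: "eqv [A] M N B \<Longrightarrow> peqv [WT A] (bullet M) (bullet N) (WT B)"
  using dialectica_sound[of "[A]" M N B gW gC] by simp

lemma pull_sound1: "eqv [A] M N B \<Longrightarrow> peqv [WT A] (pull 0 M) (pull 0 N) (PArr (CT B) (PM (CT A)))"
  using dialectica_sound[of "[A]" M N B gW gC] by simp

lemma proj_typed: "ptyped [PProd A B] (PFst (PVar 0)) A" "ptyped [PProd A B] (PSnd (PVar 0)) B"
  by (rule ptyped_rules)+

lemma lens_put_typed:
  assumes "typed [A] M B"
  shows "ptyped [PProd (WT A) (PM (CT B))] (lens_put M) (PM (CT A))"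
  unfolding lens_put_def
  by (rule ptyped.Bind[OF proj_typed(2) ptyped_pinst1[OF pull_typed1[OF assms] proj_typed(1)]])

lemma lens_put_sound:
  assumes "eqv [A] M N B"
  shows "peqv [PProd (WT A) (PM (CT B))] (lens_put M) (lens_put N) (PM (CT A))"
  unfolding lens_put_def
  by (rule peqv.Bind[OF peqv.refl[OF proj_typed(2)] peqv_pinst[OF pull_sound1[OF assms] peqv.refl[OF proj_typed(1)]]])

lemma on_arr_ELens:
  assumes "typed [A] M B"
  shows "on_arr (STLC_to_ELens gW gC) A B (cls A M B) =
    (pcls (WT A) (bullet M) (WT B),
     (pcls (PProd (WT A) (PM (CT B))) (PPair (PFst (PVar 0)) (lens_put M)) (PProd (WT A) (PM (CT A))),
      times_id P_cat (WT A) (WT B) (PM (CT B)) (pcls (WT A) (bullet M) (WT B))))"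
proof -
  have 1: "(\<Union>N\<in>cls A M B. pcls (WT A) (bullet N) (WT B)) = pcls (WT A) (bullet M) (WT B)"
    by (rule UN_cls[OF assms]) (rule pcls_eq[OF bullet_sound1[OF eqv.sym]])
  have 2: "(\<Union>N\<in>cls A M B. pcls (PProd (WT A) (PM (CT B)))
            (PPair (PFst (PVar 0)) (PBind (PSnd (PVar 0)) (pinst (pull 0 N) (PFst (PVar 0)))))
            (PProd (WT A) (PM (CT A)))) =
      pcls (PProd (WT A) (PM (CT B))) (PPair (PFst (PVar 0)) (lens_put M)) (PProd (WT A) (PM (CT A)))"
    unfolding lens_put_def[symmetric]
    by (rule UN_cls[OF assms])
      (rule pcls_eq[OF peqv.Pair[OF peqv.refl[OF proj_typed(1)] lens_put_sound[OF eqv.sym]]])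
  have 3: "(\<Union>N\<in>cls A M B. pcls (PProd (WT A) (PM (CT B)))
            (PPair (pinst (bullet N) (PFst (PVar 0))) (PSnd (PVar 0))) (PProd (WT B) (PM (CT B)))) =
      times_id P_cat (WT A) (WT B) (PM (CT B)) (pcls (WT A) (bullet M) (WT B))"
    unfolding P_times_id[OF bullet_typed1[OF assms]]
    by (rule UN_cls[OF assms])
      (rule pcls_eq[OF peqv.Pair[OF peqv_pinst[OF bullet_sound1[OF eqv.sym] peqv.refl[OF proj_typed(1)]]
          peqv.refl[OF proj_typed(2)]]])
  show ?thesis
    by (simp add: STLC_to_ELens_def Let_def 1 2 3)
qed

lemma bullet_inst:
  assumes "typed [A] M B" "typed [B] N D"
  shows "peqv [WT A] (bullet (inst N M)) (pinst (bullet N) (bullet M)) (WT D)"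
  using chain_rule[of "[B]" N D "[A]" "case_nat M Var" gW gC] assms
  by (simp add: inst_def pinst_def bullet_case_nat)

text \<open>
The chain rule for a one-variable context, where the sum has a single term.
\<close>

lemma pull_inst:
  assumes "typed [A] M B" "typed [B] N D"
  shows "peqv [WT A] (pull 0 (inst N M))
    (PLam (PBind (PApp (plift (pinst (pull 0 N) (bullet M))) (PVar 0)) (plift (pull 0 M))))
    (PArr (CT D) (PM (CT A)))"
proof -
  have 1: "peqv [WT A] (pull 0 (inst N M)) (PLam (chain_sum (Suc 0) 0 N (case_nat M Var))) (PArr (CT D) (PM (CT A)))"
    using chain_rule[of "[B]" N D "[A]" "case_nat M Var" gW gC] assms by (simp add: inst_def)
  show ?thesis
    by (rule peqv_red[OF 1])
      (simp add: chain_sum_def bullet_case_nat pinst_def red.Lam red_Plus_Zero)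
qed

text \<open>
Functoriality of the backward component: by \<open>pull_inst\<close>, the right-hand side binds \<open>z\<^sup>2\<close> to one
Kleisli composite, and the left-hand side binds \<open>z\<^sup>2\<close> to its two factors in turn.
\<close>

lemma lens_put_inst:
  assumes M: "typed [A] M B" and N: "typed [B] N D"
  defines "R \<equiv> PPair (pinst (bullet M) (PFst (PVar 0))) (PSnd (PVar 0))"
  shows "peqv [PProd (WT A) (PM (CT D))]
    (pinst (PPair (PFst (PVar 0)) (lens_put M))
       (PPair (PFst (PVar 0)) (pinst (PSnd (PPair (PFst (PVar 0)) (lens_put N))) R)))
    (PPair (PFst (PVar 0)) (lens_put (inst N M)))
    (PProd (WT A) (PM (CT A)))" (is "peqv ?\<Gamma> _ _ _")
proof -
  let ?z = "PVar 0" and ?M = "pinst (pull 0 M) (PFst (PVar 0))"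
    and ?N = "pinst (pull 0 N) (pinst (bullet M) (PFst (PVar 0)))"
  \<comment> \<open>\<open>R\<close> is the right leg for \<open>M\<close>, \<open>?X\<close> the opponent of \<open>B\<close> that \<open>N\<close> returns, \<open>?P\<close> the state handed to \<open>M\<close>.\<close>
  let ?X = "PSnd (PPair (PFst R) (PBind (PSnd R) (pinst (pull 0 N) (PFst R))))"
  let ?P = "PPair (PFst ?z) ?X"
  have bM: "ptyped ?\<Gamma> (pinst (bullet M) (PFst ?z)) (WT B)"
    by (rule ptyped_pinst1[OF bullet_typed1[OF M] proj_typed(1)])
  have R: "ptyped ?\<Gamma> R (PProd (WT B) (PM (CT D)))"
    unfolding R_def by (rule ptyped.Pair[OF bM proj_typed(2)])
  have R1: "peqv ?\<Gamma> (PFst R) (pinst (bullet M) (PFst ?z)) (WT B)"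
    unfolding R_def by (rule peqv.Fst_Pair[OF bM proj_typed(2)])
  have R2: "peqv ?\<Gamma> (PSnd R) (PSnd ?z) (PM (CT D))"
    unfolding R_def by (rule peqv.Snd_Pair[OF bM proj_typed(2)])
  have 1: "peqv ?\<Gamma> (PBind (PSnd R) (pinst (pull 0 N) (PFst R))) (PBind (PSnd ?z) ?N) (PM (CT B))"
    by (rule peqv.Bind[OF R2 peqv_pinst[OF peqv.refl[OF pull_typed1[OF N]] R1]])
  have X: "peqv ?\<Gamma> ?X (PBind (PSnd ?z) ?N) (PM (CT B))"
    by (rule peqv.trans[OF peqv.Snd_Pair[OF ptyped.Fst[OF R] conjunct1[OF peqv_typed[OF 1]]] 1])
  have X': "ptyped ?\<Gamma> ?X (PM (CT B))" using peqv_typed[OF X] by simp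
  have P1: "peqv ?\<Gamma> (PFst ?P) (PFst ?z) (WT A)"
    by (rule peqv.Fst_Pair[OF proj_typed(1) X'])
  have P2: "peqv ?\<Gamma> (PSnd ?P) (PBind (PSnd ?z) ?N) (PM (CT B))"
    by (rule peqv.trans[OF peqv.Snd_Pair[OF proj_typed(1) X'] X])
  have 2: "peqv ?\<Gamma> (PPair (PFst ?P) (PBind (PSnd ?P) (pinst (pull 0 M) (PFst ?P))))
      (PPair (PFst ?z) (PBind (PBind (PSnd ?z) ?N) ?M)) (PProd (WT A) (PM (CT A)))"
    by (rule peqv.Pair[OF P1 peqv.Bind[OF P2 peqv_pinst[OF peqv.refl[OF pull_typed1[OF M]] P1]]])
  have 3: "peqv ?\<Gamma> (lens_put (inst N M))
      (PBind (PSnd ?z) (PLam (PBind (PApp (plift ?N) ?z) (plift ?M)))) (PM (CT A))"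
  proof -
    have "pinst (PLam (PBind (PApp (plift (pinst (pull 0 N) (bullet M))) ?z) (plift (pull 0 M)))) (PFst ?z)
      = PLam (PBind (PApp (plift ?N) ?z) (plift ?M))"
      by (simp add: pinst_assoc[OF pull_typed1[OF N], symmetric]) (simp add: pinst_def)
    then show ?thesis unfolding lens_put_def
      using peqv.Bind[OF peqv.refl[OF proj_typed(2)] peqv_pinst[OF pull_inst[OF M N] peqv.refl[OF proj_typed(1)]]]
      by simp
  qed
  have 4: "PPair (PFst ?z) (PBind (PBind (PSnd ?z) ?N) ?M) \<leadsto>
      PPair (PFst ?z) (PBind (PSnd ?z) (PLam (PBind (PApp (plift ?N) ?z) (plift ?M))))"
    by (rule red.Pair[OF red.refl red.Bind_Bind])
  have "peqv ?\<Gamma> (PPair (PFst ?P) (PBind (PSnd ?P) (pinst (pull 0 M) (PFst ?P))))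
      (PPair (PFst ?z) (lens_put (inst N M))) (PProd (WT A) (PM (CT A)))"
    by (rule peqv.trans[OF peqv_red[OF 2 4] peqv.Pair[OF peqv.refl[OF proj_typed(1)] peqv.sym[OF 3]]])
  then show ?thesis
    by (simp add: lens_put_def pinst_assoc[OF pull_typed1[OF M]] pinst_assoc[OF pull_typed1[OF N]])
qed

interpretation P: category_with_products "P_cat :: ('p pty, ptm set) prod_cat"
  by (rule P_category_with_products)

lemma STLC_to_ELens_functor: "is_functor STLC_cat (ELens P_cat) (STLC_to_ELens gW gC)"
proof (intro is_functor.intro is_functor_axioms.intro STLC_category
    is_functor.axioms(1)[OF P.ELens_to_EDial_functor])
  have ob: "on_ob (STLC_to_ELens gW gC) A = (WT A, PM (CT A), Pr1 P_cat (WT A) (PM (CT A)))" for A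
    by (simp add: STLC_to_ELens_def Let_def)
  have put: "ptyped [PProd (WT A) (PM (CT B))] (PPair (PFst (PVar 0)) (lens_put M)) (PProd (WT A) (PM (CT A)))"
    if "typed [A] M B" for A B M
    by (rule ptyped.Pair[OF proj_typed(1) lens_put_typed[OF that]])
  fix A :: "'g ty"
  show "on_ob (STLC_to_ELens gW gC) A \<in> Ob (ELens P_cat)"
    by (simp add: ob ELens_def P_simps)
  show "on_arr (STLC_to_ELens gW gC) A A (Idn STLC_cat A) = Idn (ELens P_cat) (on_ob (STLC_to_ELens gW gC) A)"
  proof -
    have "PPair (PFst (PVar 0)) (lens_put (Var 0)) \<leadsto> PVar 0"
      unfolding lens_put_def
      by (rule red.trans[OF red.Pair[OF red.refl] red.surj_Pair]) (simp add: pinst_def red.Bind_Ret)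
    then have "pcls (PProd (WT A) (PM (CT A))) (PPair (PFst (PVar 0)) (lens_put (Var 0))) (PProd (WT A) (PM (CT A))) =
        pcls (PProd (WT A) (PM (CT A))) (PVar 0) (PProd (WT A) (PM (CT A)))"
      by (rule pcls_eq[OF red_peqv[OF _ put[OF typed_Var0]]])
    then show ?thesis
      using P.times_id_Idn[of "WT A" "PM (CT A)"]
      by (simp add: Idn_STLC on_arr_ELens typed_Var0 ob ELens_def P_simps)
  qed
next
  have ob: "on_ob (STLC_to_ELens gW gC) A = (WT A, PM (CT A), Pr1 P_cat (WT A) (PM (CT A)))" for A
    by (simp add: STLC_to_ELens_def Let_def)
  have put: "ptyped [PProd (WT A) (PM (CT B))] (PPair (PFst (PVar 0)) (lens_put M)) (PProd (WT A) (PM (CT A)))"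
    if "typed [A] M B" for A B M
    by (rule ptyped.Pair[OF proj_typed(1) lens_put_typed[OF that]])
  {
    fix A B :: "'g ty" and f assume "f \<in> Hom STLC_cat A B"
    then obtain M where M: "typed [A] M B" "f = cls A M B" by (auto simp: Hom_STLC)
    show "on_arr (STLC_to_ELens gW gC) A B f \<in> Hom (ELens P_cat)
        (on_ob (STLC_to_ELens gW gC) A) (on_ob (STLC_to_ELens gW gC) B)"
      using put[OF M(1)] bullet_typed1[OF M(1)]
        pcls_eq[OF peqv.Fst_Pair[OF proj_typed(1) lens_put_typed[OF M(1)]]]
      by (simp add: M on_arr_ELens ob ELens_def P_simps pcls_in_Hom P_Comp proj_typed)
  }
  fix A B D :: "'g ty" and f g assume "f \<in> Hom STLC_cat A B" "g \<in> Hom STLC_cat B D"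
  then obtain M N where M: "typed [A] M B" "f = cls A M B" and N: "typed [B] N D" "g = cls B N D"
    by (auto simp: Hom_STLC)
  note NM = typed_inst1[OF N(1) M(1)]
  let ?ZA = "PProd (WT A) (PM (CT D))" and ?ZB = "PProd (WT B) (PM (CT D))"
  have first: "pcls (WT A) (pinst (bullet N) (bullet M)) (WT D) = pcls (WT A) (bullet (inst N M)) (WT D)"
    by (rule pcls_eq[OF peqv.sym[OF bullet_inst[OF M(1) N(1)]]])
  let ?R = "PPair (pinst (bullet M) (PFst (PVar 0))) (PSnd (PVar 0))"
  have R: "ptyped [?ZA] ?R ?ZB"
    by (rule ptyped.Pair[OF ptyped_pinst1[OF bullet_typed1[OF M(1)] proj_typed(1)] proj_typed(2)])
  have "ptyped [?ZB] (PSnd (PPair (PFst (PVar 0)) (lens_put N))) (PM (CT B))"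
    by (rule ptyped.Snd[OF put[OF N(1)]])
  note X = this ptyped_pinst1[OF this R]
  note P = ptyped.Pair[OF proj_typed(1) X(2)]
  \<comment> \<open>The other instantiations must stay folded, to match the form of \<open>lens_put_inst\<close>.\<close>
  have snd: "pinst (PSnd (PVar 0)) K = PSnd K" for K by simp
  show "on_arr (STLC_to_ELens gW gC) A D (Comp STLC_cat A B D f g) =
        Comp (ELens P_cat) (on_ob (STLC_to_ELens gW gC) A) (on_ob (STLC_to_ELens gW gC) B)
          (on_ob (STLC_to_ELens gW gC) D) (on_arr (STLC_to_ELens gW gC) A B f)
          (on_arr (STLC_to_ELens gW gC) B D g)"
    using pcls_eq[OF lens_put_inst[OF M(1) N(1)]] X P R
    by (simp add: M(2) N(2) STLC_Comp[OF M(1) N(1)] on_arr_ELens NM M(1) N(1) ob ELens_def P_simps Let_def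
        P_Comp P_times_id bullet_typed1 put proj_typed P_pairing(2) first snd del: pinst_simps)
qed

text \<open>
On a pure opponent \<open>[y]\<close> the left unit law evaluates the bind; \<open>\<eta>\<close> then recovers \<open>M\<^sub>x\<close>, which shows
that passing to \<open>\<M>[C(B)]\<close> loses nothing.
\<close>

lemma lens_put_curry:
  assumes M: "typed [A] M B"
  shows "peqv [CT B, WT A] (pinst (lens_put M) (PPair (PVar 1) (PRet (PVar 0))))
      (PApp (plift (pull 0 M)) (PVar 0)) (PM (CT A))"
    and "peqv [WT A] (PLam (pinst (lens_put M) (PPair (PVar 1) (PRet (PVar 0))))) (pull 0 M)
      (PArr (CT B) (PM (CT A)))"
proof -
  let ?\<Gamma> = "[CT B, WT A]" and ?P = "PPair (PVar 1) (PRet (PVar 0))"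
  note pM = pull_typed1[OF M]
  have x: "ptyped ?\<Gamma> (PVar 1) (WT A)" by (rule ptyped_Var') simp_all
  have y: "ptyped ?\<Gamma> (PRet (PVar 0)) (PM (CT B))" by (rule ptyped_rules)+
  have lift: "pinst (pull 0 M) (PVar 1) = plift (pull 0 M)"
    unfolding pinst_def pren_as_psub by (rule psub_cong_typed[OF pM]) simp
  have "peqv ?\<Gamma> (PBind (PSnd ?P) (pinst (pull 0 M) (PFst ?P)))
      (PBind (PRet (PVar 0)) (plift (pull 0 M))) (PM (CT A))"
    unfolding lift[symmetric]
    by (rule peqv.Bind[OF peqv.Snd_Pair[OF x y] peqv_pinst[OF peqv.refl[OF pM] peqv.Fst_Pair[OF x y]]])
  then have "peqv ?\<Gamma> (PBind (PSnd ?P) (pinst (pull 0 M) (PFst ?P)))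
      (PApp (plift (pull 0 M)) (PVar 0)) (PM (CT A))"
    by (rule peqv_red) (rule red.Ret_Bind)
  then show 1: "peqv ?\<Gamma> (pinst (lens_put M) ?P) (PApp (plift (pull 0 M)) (PVar 0)) (PM (CT A))"
    by (simp add: lens_put_def pinst_assoc[OF pM])
  show "peqv [WT A] (PLam (pinst (lens_put M) ?P)) (pull 0 M) (PArr (CT B) (PM (CT A)))"
    by (rule peqv.trans[OF peqv.Lam[OF 1] peqv.eta[OF pM]])
qed

lemma on_arr_EDial:
  assumes M: "typed [A] M B"
  shows "on_arr (STLC_to_EDial gW gC) A B (cls A M B) =
    (pcls (WT A) (bullet M) (WT B), pcls (PProd (WT A) (PM (CT B))) (lens_put M) (PM (CT A)))"
proof -
  have "Comp P_cat (PProd (WT A) (PM (CT B))) (PProd (WT A) (PM (CT A))) (PM (CT A))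
      (pcls (PProd (WT A) (PM (CT B))) (PPair (PFst (PVar 0)) (lens_put M)) (PProd (WT A) (PM (CT A))))
      (pcls (PProd (WT A) (PM (CT A))) (PSnd (PVar 0)) (PM (CT A))) =
    pcls (PProd (WT A) (PM (CT B))) (lens_put M) (PM (CT A))"
    using pcls_eq[OF peqv.Snd_Pair[OF proj_typed(1) lens_put_typed[OF M]]]
    by (simp add: P_Comp[OF ptyped.Pair[OF proj_typed(1) lens_put_typed[OF M]] proj_typed(2)])
  then show ?thesis
    unfolding STLC_to_EDial_def functor_comp_def
    by (simp add: on_arr_ELens[OF M] ELens_to_EDial_def P_simps)
      (simp add: STLC_to_ELens_def Let_def P_simps)
qed

end

theorem corollary4p8:
  fixes gW gC :: "'g \<Rightarrow> 'p"
  shows "category_with_products (P_cat :: ('p pty, ptm set) prod_cat) \<and>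
    is_functor STLC_cat (ELens P_cat) (STLC_to_ELens gW gC) \<and>
    is_functor (ELens P_cat) (EDial P_cat) (ELens_to_EDial (P_cat :: ('p pty, ptm set) prod_cat)) \<and>
    is_functor STLC_cat (EDial P_cat) (STLC_to_EDial gW gC) \<and>
    (\<forall>A. on_ob (STLC_to_EDial gW gC) A =
      (W_ty gW gC A, PM (C_ty gW gC A), Idn P_cat (Prod P_cat (W_ty gW gC A) (PM (C_ty gW gC A))))) \<and>
    (\<forall>A B M. typed [A] M B \<longrightarrow>
      (let WA = W_ty gW gC A; WB = W_ty gW gC B;
           CA = C_ty gW gC A; CB = C_ty gW gC B;
           F = PBind (PSnd (PVar 0)) (pinst (pull 0 M) (PFst (PVar 0)));
           x = PVar 1; y = PVar 0;
           F_xy = pinst F (PPair x (PRet y))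
       in ptyped [WA] (bullet M) WB \<and>
          ptyped [PProd WA (PM CB)] F (PM CA) \<and>
          on_arr (STLC_to_EDial gW gC) A B (cls A M B) =
            (pcls WA (bullet M) WB, pcls (PProd WA (PM CB)) F (PM CA)) \<and>
          ptyped [WA] (pull 0 M) (PArr CB (PM CA)) \<and>
          peqv [CB, WA] F_xy (PApp (plift (pull 0 M)) y) (PM CA) \<and>
          peqv [WA] (PLam F_xy) (pull 0 M) (PArr CB (PM CA))))"
proof (intro conjI allI impI)
  interpret P: category_with_products "P_cat :: ('p pty, ptm set) prod_cat"
    by (rule P_category_with_products)
  show "category_with_products (P_cat :: ('p pty, ptm set) prod_cat)"
    by (rule P_category_with_products)
  show lens: "is_functor STLC_cat (ELens P_cat) (STLC_to_ELens gW gC)"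
    by (rule STLC_to_ELens_functor)
  show dial: "is_functor (ELens P_cat) (EDial P_cat) (ELens_to_EDial (P_cat :: ('p pty, ptm set) prod_cat))"
    by (rule P.ELens_to_EDial_functor)
  show "is_functor STLC_cat (EDial P_cat) (STLC_to_EDial gW gC)"
    unfolding STLC_to_EDial_def by (rule functor_comp_is_functor[OF lens dial])
  show "on_ob (STLC_to_EDial gW gC) A =
      (W_ty gW gC A, PM (C_ty gW gC A), Idn P_cat (Prod P_cat (W_ty gW gC A) (PM (C_ty gW gC A))))" for A
    by (simp add: STLC_to_EDial_def functor_comp_def STLC_to_ELens_def ELens_to_EDial_def Let_def)
next
  fix A B :: "'g ty" and M assume M: "typed [A] M B"
  show "let WA = W_ty gW gC A; WB = W_ty gW gC B;
           CA = C_ty gW gC A; CB = C_ty gW gC B;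
           F = PBind (PSnd (PVar 0)) (pinst (pull 0 M) (PFst (PVar 0)));
           x = PVar 1; y = PVar 0;
           F_xy = pinst F (PPair x (PRet y))
       in ptyped [WA] (bullet M) WB \<and>
          ptyped [PProd WA (PM CB)] F (PM CA) \<and>
          on_arr (STLC_to_EDial gW gC) A B (cls A M B) =
            (pcls WA (bullet M) WB, pcls (PProd WA (PM CB)) F (PM CA)) \<and>
          ptyped [WA] (pull 0 M) (PArr CB (PM CA)) \<and>
          peqv [CB, WA] F_xy (PApp (plift (pull 0 M)) y) (PM CA) \<and>
          peqv [WA] (PLam F_xy) (pull 0 M) (PArr CB (PM CA))"
    unfolding Let_def lens_put_def[symmetric]
    by (intro conjI bullet_typed1 lens_put_typed on_arr_EDial pull_typed1 lens_put_curry M)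
qed

end
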